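(* Let $\mathcal{R}=\mathbb{C}[\partial]A\oplus\mathbb{C}[\partial]B$ be a rank two Lie conformal algebra of Type II with $Q\neq0$, let $V_{\alpha,\beta}=\mathbb{C}[\partial]v$ be a nontrivial finite irreducible $\mathcal{R}$-module and let $\eta\in\mathbb{C}$. Consider extensions of $\mathcal{R}$-modules of the form $$0\longrightarrow\mathbb{C}c_\eta\longrightarrow E\longrightarrow V_{\alpha,\beta}\longrightarrow0 .\qquad(\ast)$$ Every such $E$ is, as a vector space, $\mathbb{C}c_\eta\oplus\mathbb{C}[\partial]v$ with $\mathcal{R}_\lambda c_\eta=0$, $\partial c_\eta=\eta c_\eta$ and $$A_\lambda v=(\partial+\alpha\lambda+\beta)v+f(\lambda)c_\eta,\qquad B_\lambda v=g(\lambda)c_\eta\qquad(\ast\ast)$$ for some $f(\lambda),g(\lambda)\in\mathbb{C}[\lambda]$. Nontrivial extensions of the form $(\ast)$ exist only if $\beta+\eta=0$. Moreover, they are given (up to equivalence) by $(\ast\ast)$, and the values of $\alpha$ along with the polynomials giving rise to nontrivial extensions are: $g(\lambda)=0$ and $f(\lambda)=s_1\lambda^2$ for $\alpha=1$, $f(\lambda)=s_2\lambda^3$ for $\alpha=2$, with nonzero constants $s_1,s_2$. In these cases, $\dim\mathrm{Ext}(V_{\alpha,\beta},\mathbb{C}c_\eta)=1$.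
   Context: Everything is over $\mathbb{C}$. A Lie conformal algebra $\mathcal{R}$ is a $\mathbb{C}[\partial]$-module with a $\mathbb{C}$-linear $\lambda$-bracket $\mathcal{R}\otimes\mathcal{R}\to\mathcal{R}[\lambda]$, $a\otimes b\mapsto[a_\lambda b]$, satisfying $[\partial a_\lambda b]=-\lambda[a_\lambda b]$, $[a_\lambda\partial b]=(\partial+\lambda)[a_\lambda b]$, $[a_\lambda b]=-[b_{-\lambda-\partial}a]$ and $[a_\lambda[b_\mu c]]=[[a_\lambda b]_{\lambda+\mu}c]+[b_\mu[a_\lambda c]]$. A conformal $\mathcal{R}$-module $V$ is a $\mathbb{C}[\partial]$-module with a $\mathbb{C}$-linear map $\mathcal{R}\otimes V\to V[\lambda]$, $a\otimes v\mapsto a_\lambda v$, satisfying $(\partial a)_\lambda v=-\lambda(a_\lambda v)$, $a_\lambda(\partial v)=(\partial+\lambda)a_\lambda v$, $a_\lambda(b_\mu v)=[a_\lambda b]_{\lambda+\mu}v+b_\mu(a_\lambda v)$. For $\eta\in\mathbb{C}$, $\mathbb{C}c_\eta$ is the one-dimensional module with $\partial c_\eta=\eta c_\eta$ and $\mathcal{R}_\lambda c_\eta=0$. An extension of $W$ by $V$ is an exact sequence of modules $0\to V\to E\to W\to0$. Two extensions $E,E'$ are equivalent if there is a module homomorphism $E\to E'$ compatible with the identity maps of $V$ and $W$. An extension is trivial if it is equivalent to $V\oplus W$. $\mathrm{Ext}(W,V)$ is the vector space of extension cocycles modulo those equivalent to the trivial extension, and $\dim\mathrm{Ext}(W,V)$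 is its dimension. A Type II rank two Lie conformal algebra with $Q\neq0$ has free basis $\{A,B\}$ over $\mathbb{C}[\partial]$ with $[A_\lambda A]=(\partial+2\lambda)A+Q(\partial,\lambda)B$, $[A_\lambda B]=(\partial+a\lambda)B$, $[B_\lambda B]=0$, where $a\in\{1,0,-1,-4,-6\}$ and, for some $c,d\in\mathbb{C}$, the nonzero polynomial $Q$ is: for $a=1$, $Q=c(\partial+2\lambda)$; for $a=0$, $Q=c(\partial+2\lambda)(\partial+\lambda)\lambda+d(\partial+2\lambda)\partial$; for $a=-1$, $Q=c(\partial+2\lambda)\partial^2+d(\partial+2\lambda)(\partial+\lambda)\partial\lambda$; for $a=-4$, $Q=c(\partial+2\lambda)(\partial+\lambda)^3\lambda^3$; for $a=-6$, $Q=c(\partial+2\lambda)[11(\partial+\lambda)^4\lambda^4+2(\partial+\lambda)^3\partial^2\lambda^3]$. Its nontrivial finite irreducible modules are $V_{\alpha,\beta}=\mathbb{C}[\partial]v$ (free of rank one) with $A_\lambda v=(\partial+\alpha\lambda+\beta)v$, $B_\lambda v=0$, where $\beta\in\mathbb{C}$, $0\neq\alpha\in\mathbb{C}$. *)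

theory Defs
  imports
    Complex_Main
    "HOL-Computational_Algebra.Polynomial"
    "HOL-Library.Function_Algebras"
    "HOL-Library.Product_Plus"
begin

text \<open>
  A \<open>\<complex>[\<partial>]\<close>-module is a \<^locale>\<open>module\<close> over \<^typ>\<open>complex poly\<close>: the indeterminate
  acts as \<open>\<partial>\<close>, the constant polynomial \<open>[:k:]\<close> as the scalar \<open>k\<close>.

  Elements of \<open>M[\<lambda>]\<close> have type \<open>'m poly\<close>; multiplication by \<open>\<lambda>\<close> is \<open>pCons 0\<close>, and a
  linear map \<open>f\<close> acts on coefficients by \<open>map_poly f\<close>. Elements of \<open>M[\<lambda>,\<mu>]\<close> have type
  \<open>'m poly poly\<close>, with outer variable \<open>\<mu>\<close> and inner variable \<open>\<lambda>\<close>: there \<open>\<mu>\<close> is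
  \<open>pCons 0\<close> and \<open>\<lambda>\<close> is \<open>map_poly (pCons 0)\<close>.
\<close>

abbreviation scal :: "(complex poly \<Rightarrow> 'm \<Rightarrow> 'm) \<Rightarrow> complex \<Rightarrow> 'm \<Rightarrow> 'm" where
  "scal s k \<equiv> s [:k:]"

abbreviation deriv_op :: "(complex poly \<Rightarrow> 'm \<Rightarrow> 'm) \<Rightarrow> 'm \<Rightarrow> 'm" where
  "deriv_op s \<equiv> s [:0, 1:]"

text \<open>The substitution \<open>p(\<lambda>) \<mapsto> p(\<lambda>+\<mu>)\<close> from \<open>M[\<lambda>]\<close> to \<open>M[\<lambda>,\<mu>]\<close>.\<close>

definition subst_sum :: "'m::ab_group_add poly \<Rightarrow> 'm poly poly" where
  "subst_sum p = (\<Sum>n\<le>degree p. ((\<lambda>q. map_poly (pCons 0) q + pCons 0 q) ^^ n) [:[:coeff p n:]:])"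

text \<open>The substitution \<open>p(\<lambda>) \<mapsto> p(-\<lambda>-\<partial>)\<close>, where \<open>\<partial>\<close> acts on the coefficients of \<open>p\<close>.\<close>

definition subst_skew ::
    "(complex poly \<Rightarrow> 'm \<Rightarrow> 'm) \<Rightarrow> 'm::ab_group_add poly \<Rightarrow> 'm poly" where
  "subst_skew s p = (\<Sum>n\<le>degree p. ((\<lambda>q. - pCons 0 q - map_poly (deriv_op s) q) ^^ n) [:coeff p n:])"

text \<open>The exchange \<open>P(\<lambda>,\<mu>) \<mapsto> P(\<mu>,\<lambda>)\<close> on \<open>M[\<lambda>,\<mu>]\<close>.\<close>

definition swap_vars :: "'m::ab_group_add poly poly \<Rightarrow> 'm poly poly" where
  "swap_vars P = (\<Sum>n\<le>degree P. map_poly (\<lambda>x. monom x n) (coeff P n))"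

text \<open>For \<open>P(\<lambda>) = \<Sum>\<^sub>n \<lambda>\<^sup>n a\<^sub>n\<close> this is \<open>P(\<lambda>)\<^sub>\<lambda>\<^sub>+\<^sub>\<mu> v = \<Sum>\<^sub>n \<lambda>\<^sup>n (a\<^sub>n)\<^sub>\<lambda>\<^sub>+\<^sub>\<mu> v\<close>.\<close>

definition act_at_sum ::
    "('r \<Rightarrow> 'm \<Rightarrow> 'm poly) \<Rightarrow> 'r::ab_group_add poly \<Rightarrow> 'm::ab_group_add \<Rightarrow> 'm poly poly" where
  "act_at_sum act P v =
     (\<Sum>n\<le>degree P. (map_poly (pCons 0) ^^ n) (subst_sum (act (coeff P n) v)))"

locale lie_conformal_algebra = module sR
  for sR :: "complex poly \<Rightarrow> 'r::ab_group_add \<Rightarrow> 'r" +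
  fixes br :: "'r \<Rightarrow> 'r \<Rightarrow> 'r poly"
  assumes br_add_left: "br (a + b) c = br a c + br b c"
    and br_add_right: "br a (b + c) = br a b + br a c"
    and br_scal_left: "br (scal sR k a) b = map_poly (scal sR k) (br a b)"
    and br_scal_right: "br a (scal sR k b) = map_poly (scal sR k) (br a b)"
    and br_deriv_left: "br (deriv_op sR a) b = - pCons 0 (br a b)"
    and br_deriv_right: "br a (deriv_op sR b) = map_poly (deriv_op sR) (br a b) + pCons 0 (br a b)"
    and br_skew: "br a b = - subst_skew sR (br b a)"
    and br_jacobi:
      "map_poly (br a) (br b c) = act_at_sum br (br a b) c + swap_vars (map_poly (br b) (br a c))"

locale conformal_module = lie_conformal_algebra sR br + V: module sV
  for sR :: "complex poly \<Rightarrow> 'r::ab_group_add \<Rightarrow> 'r"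
    and br :: "'r \<Rightarrow> 'r \<Rightarrow> 'r poly"
    and sV :: "complex poly \<Rightarrow> 'v::ab_group_add \<Rightarrow> 'v" +
  fixes act :: "'r \<Rightarrow> 'v \<Rightarrow> 'v poly"
  assumes act_add_left: "act (a + b) v = act a v + act b v"
    and act_add_right: "act a (v + w) = act a v + act a w"
    and act_scal_left: "act (scal sR k a) v = map_poly (scal sV k) (act a v)"
    and act_scal_right: "act a (scal sV k v) = map_poly (scal sV k) (act a v)"
    and act_deriv_left: "act (deriv_op sR a) v = - pCons 0 (act a v)"
    and act_deriv_right:
      "act a (deriv_op sV v) = map_poly (deriv_op sV) (act a v) + pCons 0 (act a v)"
    and act_jacobi:
      "map_poly (act a) (act b v) = act_at_sum act (br a b) v + swap_vars (map_poly (act b) (act a v))"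

definition conformal_hom ::
    "(complex poly \<Rightarrow> 'v::ab_group_add \<Rightarrow> 'v) \<Rightarrow> ('r \<Rightarrow> 'v \<Rightarrow> 'v poly) \<Rightarrow>
     (complex poly \<Rightarrow> 'w::ab_group_add \<Rightarrow> 'w) \<Rightarrow> ('r \<Rightarrow> 'w \<Rightarrow> 'w poly) \<Rightarrow> ('v \<Rightarrow> 'w) \<Rightarrow> bool" where
  "conformal_hom sV aV sW aW h \<longleftrightarrow>
     module_hom sV sW h \<and> (\<forall>a x. aW a (h x) = map_poly h (aV a x))"

text \<open>\<open>extension sR br sV aV sW aW sE aE i p\<close>: the maps \<open>i\<close> and \<open>p\<close> form an exact sequence
  \<open>0 \<rightarrow> V \<rightarrow> E \<rightarrow> W \<rightarrow> 0\<close> of conformal modules.\<close>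

definition extension ::
    "(complex poly \<Rightarrow> 'r::ab_group_add \<Rightarrow> 'r) \<Rightarrow> ('r \<Rightarrow> 'r \<Rightarrow> 'r poly) \<Rightarrow>
     (complex poly \<Rightarrow> 'v::ab_group_add \<Rightarrow> 'v) \<Rightarrow> ('r \<Rightarrow> 'v \<Rightarrow> 'v poly) \<Rightarrow>
     (complex poly \<Rightarrow> 'w::ab_group_add \<Rightarrow> 'w) \<Rightarrow> ('r \<Rightarrow> 'w \<Rightarrow> 'w poly) \<Rightarrow>
     (complex poly \<Rightarrow> 'e::ab_group_add \<Rightarrow> 'e) \<Rightarrow> ('r \<Rightarrow> 'e \<Rightarrow> 'e poly) \<Rightarrow>
     ('v \<Rightarrow> 'e) \<Rightarrow> ('e \<Rightarrow> 'w) \<Rightarrow> bool" where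
  "extension sR br sV aV sW aW sE aE i p \<longleftrightarrow>
     conformal_module sR br sV aV \<and> conformal_module sR br sW aW \<and> conformal_module sR br sE aE \<and>
     conformal_hom sV aV sE aE i \<and> conformal_hom sE aE sW aW p \<and>
     inj i \<and> range i = {x. p x = 0} \<and> surj p"

definition ext_equiv ::
    "(complex poly \<Rightarrow> 'e::ab_group_add \<Rightarrow> 'e) \<Rightarrow> ('r \<Rightarrow> 'e \<Rightarrow> 'e poly) \<Rightarrow> ('v \<Rightarrow> 'e) \<Rightarrow> ('e \<Rightarrow> 'w) \<Rightarrow>
     (complex poly \<Rightarrow> 'f::ab_group_add \<Rightarrow> 'f) \<Rightarrow> ('r \<Rightarrow> 'f \<Rightarrow> 'f poly) \<Rightarrow> ('v \<Rightarrow> 'f) \<Rightarrow> ('f \<Rightarrow> 'w) \<Rightarrow> bool" where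
  "ext_equiv sE aE i p sF aF j q \<longleftrightarrow>
     (\<exists>h. conformal_hom sE aE sF aF h \<and> h \<circ> i = j \<and> q \<circ> h = p)"

definition poly_pair :: "'v::ab_group_add poly \<Rightarrow> 'w::ab_group_add poly \<Rightarrow> ('v \<times> 'w) poly" where
  "poly_pair p q = map_poly (\<lambda>x. (x, 0)) p + map_poly (\<lambda>y. (0, y)) q"

definition sum_smul ::
    "(complex poly \<Rightarrow> 'v \<Rightarrow> 'v) \<Rightarrow> (complex poly \<Rightarrow> 'w \<Rightarrow> 'w) \<Rightarrow> complex poly \<Rightarrow> 'v \<times> 'w \<Rightarrow> 'v \<times> 'w" where
  "sum_smul sV sW r z = (sV r (fst z), sW r (snd z))"

definition sum_act ::
    "('r \<Rightarrow> 'v::ab_group_add \<Rightarrow> 'v poly) \<Rightarrow> ('r \<Rightarrow> 'w::ab_group_add \<Rightarrow> 'w poly) \<Rightarrow>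
     'r \<Rightarrow> 'v \<times> 'w \<Rightarrow> ('v \<times> 'w) poly" where
  "sum_act aV aW a z = poly_pair (aV a (fst z)) (aW a (snd z))"

definition trivial_ext ::
    "(complex poly \<Rightarrow> 'v::ab_group_add \<Rightarrow> 'v) \<Rightarrow> ('r \<Rightarrow> 'v \<Rightarrow> 'v poly) \<Rightarrow>
     (complex poly \<Rightarrow> 'w::ab_group_add \<Rightarrow> 'w) \<Rightarrow> ('r \<Rightarrow> 'w \<Rightarrow> 'w poly) \<Rightarrow>
     (complex poly \<Rightarrow> 'e::ab_group_add \<Rightarrow> 'e) \<Rightarrow> ('r \<Rightarrow> 'e \<Rightarrow> 'e poly) \<Rightarrow>
     ('v \<Rightarrow> 'e) \<Rightarrow> ('e \<Rightarrow> 'w) \<Rightarrow> bool" where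
  "trivial_ext sV aV sW aW sE aE i p \<longleftrightarrow>
     ext_equiv sE aE i p (sum_smul sV sW) (sum_act aV aW) (\<lambda>x. (x, 0)) snd"

text \<open>
  A pair \<open>(\<phi>, \<psi>)\<close> twists the direct sum: \<open>r(x, w) = (rx + \<phi>(r)w, rw)\<close> for \<open>r \<in> \<complex>[\<partial>]\<close> and
  \<open>a\<^sub>\<lambda>(x, w) = (a\<^sub>\<lambda>x + \<psi>(a)w, a\<^sub>\<lambda>w)\<close>. It is a cocycle if the result is an extension whose
  underlying complex vector space is the direct sum, that is \<open>\<phi>(k) = 0\<close> for scalars \<open>k\<close>.
\<close>

type_synonym ('r, 'w, 'v) cochain = "(complex poly \<Rightarrow> 'w \<Rightarrow> 'v) \<times> ('r \<Rightarrow> 'w \<Rightarrow> 'v poly)"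

definition twist_smul ::
    "(complex poly \<Rightarrow> 'v::ab_group_add \<Rightarrow> 'v) \<Rightarrow> (complex poly \<Rightarrow> 'w \<Rightarrow> 'w) \<Rightarrow>
     (complex poly \<Rightarrow> 'w \<Rightarrow> 'v) \<Rightarrow> complex poly \<Rightarrow> 'v \<times> 'w \<Rightarrow> 'v \<times> 'w" where
  "twist_smul sV sW \<phi> r z = (sV r (fst z) + \<phi> r (snd z), sW r (snd z))"

definition twist_act ::
    "('r \<Rightarrow> 'v::ab_group_add \<Rightarrow> 'v poly) \<Rightarrow> ('r \<Rightarrow> 'w::ab_group_add \<Rightarrow> 'w poly) \<Rightarrow>
     ('r \<Rightarrow> 'w \<Rightarrow> 'v poly) \<Rightarrow> 'r \<Rightarrow> 'v \<times> 'w \<Rightarrow> ('v \<times> 'w) poly" where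
  "twist_act aV aW \<psi> a z = poly_pair (aV a (fst z) + \<psi> a (snd z)) (aW a (snd z))"

definition ext_cocycles ::
    "(complex poly \<Rightarrow> 'r::ab_group_add \<Rightarrow> 'r) \<Rightarrow> ('r \<Rightarrow> 'r \<Rightarrow> 'r poly) \<Rightarrow>
     (complex poly \<Rightarrow> 'w::ab_group_add \<Rightarrow> 'w) \<Rightarrow> ('r \<Rightarrow> 'w \<Rightarrow> 'w poly) \<Rightarrow>
     (complex poly \<Rightarrow> 'v::ab_group_add \<Rightarrow> 'v) \<Rightarrow> ('r \<Rightarrow> 'v \<Rightarrow> 'v poly) \<Rightarrow>
     ('r, 'w, 'v) cochain set" where
  "ext_cocycles sR br sW aW sV aV =
     {(\<phi>, \<psi>). (\<forall>k w. \<phi> [:k:] w = 0) \<and>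
        extension sR br sV aV sW aW (twist_smul sV sW \<phi>) (twist_act aV aW \<psi>) (\<lambda>x. (x, 0)) snd}"

definition trivial_cocycles ::
    "(complex poly \<Rightarrow> 'r::ab_group_add \<Rightarrow> 'r) \<Rightarrow> ('r \<Rightarrow> 'r \<Rightarrow> 'r poly) \<Rightarrow>
     (complex poly \<Rightarrow> 'w::ab_group_add \<Rightarrow> 'w) \<Rightarrow> ('r \<Rightarrow> 'w \<Rightarrow> 'w poly) \<Rightarrow>
     (complex poly \<Rightarrow> 'v::ab_group_add \<Rightarrow> 'v) \<Rightarrow> ('r \<Rightarrow> 'v \<Rightarrow> 'v poly) \<Rightarrow>
     ('r, 'w, 'v) cochain set" where
  "trivial_cocycles sR br sW aW sV aV =
     {(\<phi>, \<psi>) \<in> ext_cocycles sR br sW aW sV aV.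
        trivial_ext sV aV sW aW (twist_smul sV sW \<phi>) (twist_act aV aW \<psi>) (\<lambda>x. (x, 0)) snd}"

definition cochain_scale ::
    "(complex poly \<Rightarrow> 'v::ab_group_add \<Rightarrow> 'v) \<Rightarrow> complex \<Rightarrow>
     ('r, 'w, 'v) cochain \<Rightarrow> ('r, 'w, 'v) cochain" where
  "cochain_scale sV k z =
     (\<lambda>r w. scal sV k (fst z r w), \<lambda>a w. map_poly (scal sV k) (snd z a w))"

text \<open>\<open>quotient_dim scale Z N n\<close>: the quotient of the subspace \<open>Z\<close> by the subspace \<open>N\<close> has
  dimension \<open>n\<close>, i.e. the classes of some \<open>n\<close> elements of \<open>Z\<close> form a basis of \<open>Z/N\<close>.\<close>

definition quotient_dim :: "(complex \<Rightarrow> 'z \<Rightarrow> 'z) \<Rightarrow> 'z::ab_group_add set \<Rightarrow> 'z set \<Rightarrow> nat \<Rightarrow> bool" where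
  "quotient_dim scale Z N n \<longleftrightarrow>
     (\<exists>S \<subseteq> Z. finite S \<and> card S = n \<and>
        (\<forall>z\<in>Z. \<exists>!k. (\<forall>s. s \<notin> S \<longrightarrow> k s = 0) \<and> z - (\<Sum>s\<in>S. scale (k s) s) \<in> N))"

text \<open>\<open>ext_dim sR br sW aW sV aV n\<close> says \<open>dim Ext(W, V) = n\<close>.\<close>

definition ext_dim ::
    "(complex poly \<Rightarrow> 'r::ab_group_add \<Rightarrow> 'r) \<Rightarrow> ('r \<Rightarrow> 'r \<Rightarrow> 'r poly) \<Rightarrow>
     (complex poly \<Rightarrow> 'w::ab_group_add \<Rightarrow> 'w) \<Rightarrow> ('r \<Rightarrow> 'w \<Rightarrow> 'w poly) \<Rightarrow>
     (complex poly \<Rightarrow> 'v::ab_group_add \<Rightarrow> 'v) \<Rightarrow> ('r \<Rightarrow> 'v \<Rightarrow> 'v poly) \<Rightarrow> nat \<Rightarrow> bool" where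
  "ext_dim sR br sW aW sV aV n \<longleftrightarrow>
     quotient_dim (cochain_scale sV)
       (ext_cocycles sR br sW aW sV aV) (trivial_cocycles sR br sW aW sV aV) n"

text \<open>
  Elements of \<open>\<complex>[\<partial>,\<lambda>]\<close> have type \<^typ>\<open>complex poly poly\<close>, with outer variable \<open>\<lambda>\<close> and
  coefficients in \<open>\<complex>[\<partial>]\<close>; \<open>papp s P x\<close> is \<open>P(\<partial>,\<lambda>)x \<in> M[\<lambda>]\<close>.
\<close>

abbreviation pd :: "complex poly poly" where "pd \<equiv> [:[:0, 1:]:]"
abbreviation lam :: "complex poly poly" where "lam \<equiv> [:0, 1:]"
abbreviation cst :: "complex \<Rightarrow> complex poly poly" where "cst k \<equiv> [:[:k:]:]"

definition papp ::
    "(complex poly \<Rightarrow> 'm::ab_group_add \<Rightarrow> 'm) \<Rightarrow> complex poly poly \<Rightarrow> 'm \<Rightarrow> 'm poly" where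
  "papp s P x = map_poly (\<lambda>r. s r x) P"

definition type_II_poly :: "complex \<Rightarrow> complex poly poly \<Rightarrow> bool" where
  "type_II_poly a Q \<longleftrightarrow> Q \<noteq> 0 \<and> (\<exists>c d.
     (a = 1 \<and> Q = cst c * (pd + 2 * lam)) \<or>
     (a = 0 \<and> Q = cst c * (pd + 2 * lam) * (pd + lam) * lam + cst d * (pd + 2 * lam) * pd) \<or>
     (a = -1 \<and> Q = cst c * (pd + 2 * lam) * pd ^ 2
                   + cst d * (pd + 2 * lam) * (pd + lam) * pd * lam) \<or>
     (a = -4 \<and> Q = cst c * (pd + 2 * lam) * (pd + lam) ^ 3 * lam ^ 3) \<or>
     (a = -6 \<and> Q = cst c * (pd + 2 * lam) *
                   (11 * (pd + lam) ^ 4 * lam ^ 4 + 2 * (pd + lam) ^ 3 * pd ^ 2 * lam ^ 3)))"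

definition type_II_algebra ::
    "(complex poly \<Rightarrow> 'r::ab_group_add \<Rightarrow> 'r) \<Rightarrow> ('r \<Rightarrow> 'r \<Rightarrow> 'r poly) \<Rightarrow>
     'r \<Rightarrow> 'r \<Rightarrow> complex \<Rightarrow> complex poly poly \<Rightarrow> bool" where
  "type_II_algebra sR br A B a Q \<longleftrightarrow>
     lie_conformal_algebra sR br \<and>
     A \<noteq> B \<and> \<not> module.dependent sR {A, B} \<and> module.span sR {A, B} = UNIV \<and>
     type_II_poly a Q \<and>
     br A A = papp sR (pd + 2 * lam) A + papp sR Q B \<and>
     br A B = papp sR (pd + cst a * lam) B \<and>
     br B B = 0"

text \<open>The module \<open>V\<^sub>\<alpha>\<^sub>,\<^sub>\<beta> = \<complex>[\<partial>]v\<close>.\<close>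

definition irreducible_V ::
    "(complex poly \<Rightarrow> 'r::ab_group_add \<Rightarrow> 'r) \<Rightarrow> ('r \<Rightarrow> 'r \<Rightarrow> 'r poly) \<Rightarrow> 'r \<Rightarrow> 'r \<Rightarrow>
     complex \<Rightarrow> complex \<Rightarrow>
     (complex poly \<Rightarrow> 'v::ab_group_add \<Rightarrow> 'v) \<Rightarrow> ('r \<Rightarrow> 'v \<Rightarrow> 'v poly) \<Rightarrow> 'v \<Rightarrow> bool" where
  "irreducible_V sR br A B \<alpha> \<beta> sV aV v \<longleftrightarrow>
     conformal_module sR br sV aV \<and>
     \<not> module.dependent sV {v} \<and> module.span sV {v} = UNIV \<and>
     \<alpha> \<noteq> 0 \<and> aV A v = papp sV (pd + cst \<alpha> * lam + cst \<beta>) v \<and> aV B v = 0"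

text \<open>The module \<open>\<complex>c\<^sub>\<eta>\<close>.\<close>

definition one_dim_module ::
    "(complex poly \<Rightarrow> 'r::ab_group_add \<Rightarrow> 'r) \<Rightarrow> ('r \<Rightarrow> 'r \<Rightarrow> 'r poly) \<Rightarrow> complex \<Rightarrow>
     (complex poly \<Rightarrow> 'c::ab_group_add \<Rightarrow> 'c) \<Rightarrow> ('r \<Rightarrow> 'c \<Rightarrow> 'c poly) \<Rightarrow> 'c \<Rightarrow> bool" where
  "one_dim_module sR br \<eta> sC aC c \<longleftrightarrow>
     conformal_module sR br sC aC \<and>
     c \<noteq> 0 \<and> (\<forall>x. \<exists>k. x = scal sC k c) \<and>
     deriv_op sC c = scal sC \<eta> c \<and> (\<forall>a. aC a c = 0)"

text \<open>\<open>E = \<complex>c \<oplus> \<complex>[\<partial>]v\<close> with \<open>\<partial>c = \<eta>c\<close>, \<open>R\<^sub>\<lambda>c = 0\<close>, \<open>A\<^sub>\<lambda>v = (\<partial> + \<alpha>\<lambda> + \<beta>)v + f(\<lambda>)c\<close> and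
  \<open>B\<^sub>\<lambda>v = g(\<lambda>)c\<close>.\<close>

definition standard_form ::
    "(complex poly \<Rightarrow> 'e::ab_group_add \<Rightarrow> 'e) \<Rightarrow> ('r \<Rightarrow> 'e \<Rightarrow> 'e poly) \<Rightarrow> 'r \<Rightarrow> 'r \<Rightarrow>
     complex \<Rightarrow> complex \<Rightarrow> complex \<Rightarrow> 'e \<Rightarrow> 'e \<Rightarrow> complex poly \<Rightarrow> complex poly \<Rightarrow> bool" where
  "standard_form sE aE A B \<alpha> \<beta> \<eta> c v f g \<longleftrightarrow>
     (\<forall>x. \<exists>!z. x = scal sE (fst z) c + sE (snd z) v) \<and>
     deriv_op sE c = scal sE \<eta> c \<and> (\<forall>a. aE a c = 0) \<and>
     aE A v = papp sE (pd + cst \<alpha> * lam + cst \<beta>) v + map_poly (\<lambda>k. scal sE k c) f \<and>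
     aE B v = map_poly (\<lambda>k. scal sE k c) g"

end

theory Submission
  imports Defs
begin

text \<open>
  A \<open>\<lambda>\<close>-identity in a conformal module \<open>M\<close> is an identity in \<open>M[\<lambda>]\<close> or \<open>M[\<lambda>,\<mu>]\<close>. Applying to the
  coefficients an additive functional \<open>\<chi> : M \<rightarrow> \<complex>\<close> with \<open>\<chi>(\<partial>m) = z\<chi>(m)\<close>, and numbers to the
  variables, makes it an identity of complex numbers in which \<open>\<partial>\<close> has disappeared as well. Such a
  functional is evaluation at \<open>\<partial> = z\<close> of a coordinate; sesquilinearity says that
  \<open>m \<mapsto> \<chi>(a\<^sub>x m)\<close> is again one, with eigenvalue \<open>z + x\<close>, and \<open>a \<mapsto> \<chi>(a\<^sub>x m)\<close> is one on the algebra, with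
  eigenvalue \<open>-x\<close>. So every bracket and action is determined by its values at the generators
  (\<open>ev_act_R\<close>), and enough functionals together recover the \<open>\<lambda>\<close>-identity
  (\<open>jacobi_of_jacobi_at\<close>).

  Let \<open>u\<close> lift \<open>v\<close> to an extension, put \<open>\<gamma> = \<beta> + \<eta>\<close> and write \<open>A\<^sub>\<lambda>u = (\<partial> + \<alpha>\<lambda> + \<beta>)u + f(\<lambda>)c\<close>,
  \<open>B\<^sub>\<lambda>u = g(\<lambda>)c\<close>. The \<open>c\<close>-coordinates of the Jacobi identities for \<open>(A,B,u)\<close> and \<open>(A,A,u)\<close> are
  \<open>(\<gamma> + y + \<alpha>x) g(y) = (y - (a-1)x) g(x+y)\<close> and
  \<open>(\<gamma> + x + \<alpha>y) f(x) - (\<gamma> + y + \<alpha>x) f(y) = (x-y) f(x+y) + Q(-x-y,x) g(x+y)\<close>.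
  A nonzero \<open>g\<close> in the first one needs \<open>\<gamma> = 0\<close> and is a constant with \<open>\<alpha> = 1 - a\<close>, or linear with
  \<open>\<alpha> = a = 1\<close> (\<open>B_equation_solutions\<close>). The coefficients of \<open>y\<^sup>0, \<dots>, y\<^sup>3\<close> in the second
  equation then contradict \<open>Q \<noteq> 0\<close> in each of the five families of \<open>Q\<close>
  (\<open>A_equation_excludes_B\<close>), so \<open>g = 0\<close>, and they leave for \<open>f\<close> the multiples of \<open>\<gamma> + \<alpha>x\<close>,
  to which, if \<open>\<gamma> = 0\<close>, a multiple of \<open>x\<^sup>2\<close> for \<open>\<alpha> = 1\<close> and of \<open>x\<^sup>3\<close> for \<open>\<alpha> = 2\<close> may be added
  (\<open>homogeneous_A_equation_solutions\<close>).

  Replacing \<open>u\<close> by \<open>u + kc\<close> subtracts \<open>k(\<gamma> + \<alpha>x)\<close> from \<open>f\<close>, and the extension splits exactly when \<open>f\<close>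
  can be made zero in this way (\<open>trivial_ext_iff\<close>). Conversely, every solution \<open>f\<close> of the second
  equation with \<open>g = 0\<close> extends sesquilinearly to a cocycle on the whole algebra, which can be added to
  the action of any extension (\<open>extension_shift\<close>). Added to the direct sum it yields the listed
  extensions; subtracted from an arbitrary extension it shows that the class of the listed cocycle is
  a basis of \<open>Ext\<close>.
\<close>

section \<open>Evaluating polynomials with coefficients in a module\<close>

lemma map_poly_plus:
  fixes h :: "'a::ab_group_add \<Rightarrow> 'b::ab_group_add"
  assumes "additive h"
  shows "map_poly h (p + q) = map_poly h p + map_poly h q"
proof -
  interpret additive h by fact
  show ?thesis by (intro poly_eqI) (simp add: coeff_map_poly zero add)
qed

text \<open>The value \<open>\<Sum>\<^sub>n \<chi>(p\<^sub>n) x\<^sup>n\<close>. A type of module elements has no multiplication, so \<open>p\<close>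
  itself cannot be evaluated; the functional carries the evaluation over to \<open>\<complex>[\<lambda>]\<close>.\<close>

definition ev :: "('m::ab_group_add \<Rightarrow> complex) \<Rightarrow> 'm poly \<Rightarrow> complex \<Rightarrow> complex" where
  "ev \<chi> p x = poly (map_poly \<chi> p) x"

lemma ev_conv_sum:
  assumes "\<chi> 0 = 0" "degree p \<le> N"
  shows "ev \<chi> p x = (\<Sum>n\<le>N. \<chi> (coeff p n) * x ^ n)"
proof -
  have "degree (map_poly \<chi> p) \<le> N"
    using assms(2) map_poly_degree_leq le_trans by blast
  then have "ev \<chi> p x = (\<Sum>n\<le>N. coeff (map_poly \<chi> p) n * x ^ n)"
    unfolding ev_def
    by (subst poly_as_sum_of_monoms'[symmetric]) (simp_all add: poly_sum poly_monom)
  with assms(1) show ?thesis by (simp add: coeff_map_poly)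
qed

lemma ev_zero [simp]: "ev \<chi> 0 x = 0"
  by (simp add: ev_def)

lemma ev_add_poly:
  assumes "additive \<chi>"
  shows "ev \<chi> (p + q) x = ev \<chi> p x + ev \<chi> q x"
  using assms by (simp add: ev_def map_poly_plus)

lemma additive_ev: "additive \<chi> \<Longrightarrow> additive (\<lambda>p. ev \<chi> p x)"
  by (unfold_locales) (simp add: ev_add_poly)

lemma ev_pCons: "additive \<chi> \<Longrightarrow> ev \<chi> (pCons m p) x = \<chi> m + x * ev \<chi> p x"
  by (simp add: ev_def map_poly_pCons additive.zero[of \<chi>])

lemma ev_map_poly: "\<chi> 0 = 0 \<Longrightarrow> h 0 = 0 \<Longrightarrow> ev \<chi> (map_poly h p) x = ev (\<lambda>m. \<chi> (h m)) p x"
  by (simp add: ev_def map_poly_map_poly comp_def)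

lemma ev_monom: "additive \<chi> \<Longrightarrow> ev \<chi> (monom m n) x = \<chi> m * x ^ n"
  by (simp add: ev_def map_poly_monom additive.zero[of \<chi>] poly_monom)

lemma ev_add_fun:
  assumes "\<chi> 0 = 0" "\<chi>' 0 = 0"
  shows "ev (\<lambda>m. \<chi> m + \<chi>' m) p x = ev \<chi> p x + ev \<chi>' p x"
  using assms by (simp add: ev_conv_sum[OF _ order_refl] sum.distrib algebra_simps)

lemma ev_mult_fun:
  assumes "\<chi> 0 = 0"
  shows "ev (\<lambda>m. k * \<chi> m) p x = k * ev \<chi> p x"
  using assms by (simp add: ev_conv_sum[OF _ order_refl] sum_distrib_left algebra_simps)

lemma ev_id [simp]: "ev (\<lambda>k. k) p x = poly p x"
  by (simp add: ev_def)

lemma ev_zero_fun [simp]: "ev (\<lambda>_. 0) p x = 0"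
  by (simp add: ev_conv_sum[OF _ order_refl])

lemma ev_poly: "ev (\<lambda>r. poly r z) P x = poly (poly P [:x:]) z"
proof (induction P)
  case (pCons p P)
  have "additive (\<lambda>r. poly r z)" by unfold_locales simp
  with pCons show ?case by (simp add: ev_pCons)
qed simp

lemma ev_eq_0D:
  assumes "\<chi> 0 = 0" "\<And>x. ev \<chi> p x = 0"
  shows "\<chi> (coeff p n) = 0"
proof -
  have "map_poly \<chi> p = 0" using assms(2) by (auto simp: ev_def simp flip: poly_all_0_iff_0)
  then have "coeff (map_poly \<chi> p) n = 0" by simp
  with assms(1) show ?thesis by (simp add: coeff_map_poly)
qed

text \<open>As in \<open>M[\<lambda>,\<mu>]\<close>, the outer variable is \<open>\<mu>\<close>, here set to \<open>y\<close>, and the inner one is \<open>\<lambda>\<close>, set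
  to \<open>x\<close>.\<close>

abbreviation ev2 :: "('m::ab_group_add \<Rightarrow> complex) \<Rightarrow> 'm poly poly \<Rightarrow> complex \<Rightarrow> complex \<Rightarrow> complex" where
  "ev2 \<chi> P x y \<equiv> ev (\<lambda>q. ev \<chi> q x) P y"

lemma ev2_lambda:
  assumes "additive \<chi>"
  shows "ev2 \<chi> (map_poly (pCons 0) P) x y = x * ev2 \<chi> P x y"
  using assms by (simp add: ev_map_poly ev_pCons additive.zero[of \<chi>] ev_mult_fun)

lemma ev2_subst_sum:
  assumes "additive \<chi>"
  shows "ev2 \<chi> (subst_sum p) x y = ev \<chi> p (x + y)"
proof -
  note add2 = additive_ev[OF additive_ev[OF assms]]
  have pow: "ev2 \<chi> (((\<lambda>q. map_poly (pCons 0) q + pCons 0 q) ^^ n) [:[:m:]:]) x y = \<chi> m * (x + y) ^ n"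
    for n m
  proof (induction n)
    case 0 show ?case using assms by (simp add: ev_pCons additive_ev)
  next
    case (Suc n)
    then show ?case using assms
      by (simp add: additive.add[OF add2] ev2_lambda ev_pCons additive_ev algebra_simps)
  qed
  show ?thesis
    by (simp add: subst_sum_def additive.sum[OF add2] pow ev_conv_sum[of \<chi> p, OF _ order_refl]
        additive.zero[OF assms])
qed

lemma ev2_swap_vars:
  assumes "additive \<chi>"
  shows "ev2 \<chi> (swap_vars P) x y = ev2 \<chi> P y x"
proof -
  have "ev2 \<chi> (map_poly (\<lambda>m. monom m n) q) x y = ev \<chi> q y * x ^ n" for n q
    using assms ev_mult_fun[of \<chi> "x ^ n" q y]
    by (simp add: ev_map_poly ev_monom additive.zero[of \<chi>] mult.commute)
  then show ?thesis
    using assms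
    by (simp add: swap_vars_def additive.sum[OF additive_ev[OF additive_ev]]
        ev_conv_sum[of "\<lambda>q. ev \<chi> q y", OF _ order_refl])
qed

text \<open>The right-hand side evaluates at \<open>x\<close> the functional \<open>r \<mapsto> \<chi>(r\<^bsub>x+y\<^esub> v)\<close> of the algebra, so
  the nested action has become a one-variable evaluation.\<close>

lemma ev2_act_at_sum:
  assumes "additive \<chi>" and "\<And>a b v. act (a + b) v = act a v + act b v"
  shows "ev2 \<chi> (act_at_sum act P v) x y = ev (\<lambda>r. ev \<chi> (act r v) (x + y)) P x"
proof -
  have zero: "act 0 v = 0"
    using assms(2)[of 0 0 v] by simp
  have pow: "ev2 \<chi> ((map_poly (pCons 0) ^^ n) S) x y = ev2 \<chi> S x y * x ^ n" for n S
    by (induction n) (simp_all add: ev2_lambda[OF assms(1)])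
  show ?thesis
    by (simp add: act_at_sum_def additive.sum[OF additive_ev[OF additive_ev[OF assms(1)]]] pow
        ev2_subst_sum[OF assms(1)] ev_conv_sum[of _ P, OF _ order_refl] zero)
qed

text \<open>A functional that factors through the specialization \<open>M/(\<partial> - z)M\<close>.\<close>

definition eigenfunctional ::
    "(complex poly \<Rightarrow> 'm::ab_group_add \<Rightarrow> 'm) \<Rightarrow> complex \<Rightarrow> ('m \<Rightarrow> complex) \<Rightarrow> bool" where
  "eigenfunctional s z \<chi> \<longleftrightarrow> additive \<chi> \<and> (\<forall>r m. \<chi> (s r m) = poly r z * \<chi> m)"

lemma eigenfunctional_additive: "eigenfunctional s z \<chi> \<Longrightarrow> additive \<chi>"
  and eigenfunctional_smul: "eigenfunctional s z \<chi> \<Longrightarrow> \<chi> (s r m) = poly r z * \<chi> m"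
  by (simp_all add: eigenfunctional_def)

text \<open>On \<open>M/(\<partial> - z)M\<close> the substitution \<open>\<lambda> \<mapsto> -\<lambda>-\<partial>\<close> is the affine map \<open>x \<mapsto> -x-z\<close>.\<close>

lemma ev_subst_skew:
  assumes "module s" "eigenfunctional s z \<chi>"
  shows "ev \<chi> (subst_skew s p) x = ev \<chi> p (- x - z)"
proof -
  note add = eigenfunctional_additive[OF assms(2)]
  have s0: "s r 0 = 0" for r using assms(1) by (simp add: module.scale_zero_right)
  have d: "ev \<chi> (map_poly (deriv_op s) q) x = z * ev \<chi> q x" for q
    by (simp add: ev_map_poly s0 additive.zero[OF add] eigenfunctional_smul[OF assms(2)] ev_mult_fun)
  have pow: "ev \<chi> (((\<lambda>q. - pCons 0 q - map_poly (deriv_op s) q) ^^ n) [:m:]) x = \<chi> m * (- x - z) ^ n"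
    for n m
  proof (induction n)
    case 0 show ?case using add by (simp add: ev_pCons)
  next
    case (Suc n)
    then show ?case using add
      by (simp add: additive.diff[OF additive_ev[OF add]] additive.minus[OF additive_ev[OF add]]
          d ev_pCons additive.zero[of \<chi>] algebra_simps del: minus_pCons)
  qed
  show ?thesis
    by (simp add: subst_skew_def additive.sum[OF additive_ev[OF add]] pow
        ev_conv_sum[of \<chi> p, OF _ order_refl] additive.zero[OF add] del: minus_pCons)
qed

lemma ev_papp:
  assumes "module s" "eigenfunctional s z \<chi>"
  shows "ev \<chi> (papp s P m) x = poly (poly P [:x:]) z * \<chi> m"
proof -
  have "ev \<chi> (papp s P m) x = ev (\<lambda>r. \<chi> m * poly r z) P x"
    using assms(1)
    by (simp add: papp_def ev_map_poly module.scale_zero_left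
        additive.zero[OF eigenfunctional_additive[OF assms(2)]]
        eigenfunctional_smul[OF assms(2)] mult.commute)
  then show ?thesis by (simp add: ev_mult_fun ev_poly mult.commute)
qed

text \<open>The Jacobi identity after applying \<open>\<chi>\<close> and setting \<open>\<lambda> = x\<close>, \<open>\<mu> = y\<close>.\<close>

definition jacobi_at ::
    "('r::ab_group_add \<Rightarrow> 'r \<Rightarrow> 'r poly) \<Rightarrow> ('r \<Rightarrow> 'm::ab_group_add \<Rightarrow> 'm poly) \<Rightarrow> ('m \<Rightarrow> complex) \<Rightarrow> bool" where
  "jacobi_at br act \<chi> \<longleftrightarrow> (\<forall>a b m x y.
     ev (\<lambda>n. ev \<chi> (act a n) x) (act b m) y =
     ev (\<lambda>r. ev \<chi> (act r m) (x + y)) (br a b) x + ev (\<lambda>n. ev \<chi> (act b n) y) (act a m) x)"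

lemma jacobi_atD:
  assumes "jacobi_at br act \<chi>"
  shows "ev (\<lambda>n. ev \<chi> (act a n) x) (act b m) y =
     ev (\<lambda>r. ev \<chi> (act r m) (x + y)) (br a b) x + ev (\<lambda>n. ev \<chi> (act b n) y) (act a m) x"
  using assms unfolding jacobi_at_def by blast

context
  fixes br :: "'r::ab_group_add \<Rightarrow> 'r \<Rightarrow> 'r poly" and act :: "'r \<Rightarrow> 'm::ab_group_add \<Rightarrow> 'm poly"
  assumes add_left: "\<And>a b m. act (a + b) m = act a m + act b m"
    and add_right: "\<And>a m n. act a (m + n) = act a m + act a n"
begin

lemma ev2_jacobi_sides:
  assumes "additive \<chi>"
  shows "ev2 \<chi> (map_poly (act a) (act b m)) x y = ev (\<lambda>n. ev \<chi> (act a n) x) (act b m) y"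
    and "ev2 \<chi> (act_at_sum act (br a b) m + swap_vars (map_poly (act b) (act a m))) x y =
      ev (\<lambda>r. ev \<chi> (act r m) (x + y)) (br a b) x + ev (\<lambda>n. ev \<chi> (act b n) y) (act a m) x"
proof -
  have zero: "act a 0 = 0" for a
    using add_right[of a 0 0] by simp
  show "ev2 \<chi> (map_poly (act a) (act b m)) x y = ev (\<lambda>n. ev \<chi> (act a n) x) (act b m) y"
    by (simp add: ev_map_poly zero)
  show "ev2 \<chi> (act_at_sum act (br a b) m + swap_vars (map_poly (act b) (act a m))) x y =
      ev (\<lambda>r. ev \<chi> (act r m) (x + y)) (br a b) x + ev (\<lambda>n. ev \<chi> (act b n) y) (act a m) x"
    by (simp add: additive.add[OF additive_ev[OF additive_ev[OF assms]]] ev2_act_at_sum[OF assms add_left]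
        ev2_swap_vars[OF assms] ev_map_poly zero)
qed

lemma jacobi_at_of_jacobi:
  assumes "\<And>a b m. map_poly (act a) (act b m) =
      act_at_sum act (br a b) m + swap_vars (map_poly (act b) (act a m))"
    and "additive \<chi>"
  shows "jacobi_at br act \<chi>"
  unfolding jacobi_at_def
  by (intro allI box_equals[OF _ ev2_jacobi_sides[OF assms(2)]] assms(1)[THEN arg_cong])

text \<open>A polynomial over \<open>\<complex>\<close> that vanishes everywhere is zero, so every functional in \<open>X\<close> kills all
  coefficients of the difference of the two sides.\<close>

lemma jacobi_of_jacobi_at:
  assumes sep: "\<And>m. (\<And>\<chi>. \<chi> \<in> X \<Longrightarrow> \<chi> m = 0) \<Longrightarrow> m = 0"
    and X: "\<And>\<chi>. \<chi> \<in> X \<Longrightarrow> additive \<chi> \<and> jacobi_at br act \<chi>"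
  shows "map_poly (act a) (act b m) =
      act_at_sum act (br a b) m + swap_vars (map_poly (act b) (act a m))" (is "?L = ?R")
proof -
  have "coeff (coeff (?L - ?R) n) k = 0" for n k
  proof (rule sep)
    fix \<chi> assume "\<chi> \<in> X"
    from X[OF this] have add: "additive \<chi>" and jac: "jacobi_at br act \<chi>" by blast+
    have zero2: "ev2 \<chi> (?L - ?R) x y = 0" for x y
      unfolding additive.diff[OF additive_ev[OF additive_ev[OF add]]] ev2_jacobi_sides[OF add]
      unfolding right_minus_eq by (rule jacobi_atD[OF jac])
    have "ev \<chi> (coeff (?L - ?R) n) x = 0" for x
      by (rule ev_eq_0D[where \<chi> = "\<lambda>q. ev \<chi> q x", OF ev_zero zero2])
    then show "\<chi> (coeff (coeff (?L - ?R) n) k) = 0"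
      by (rule ev_eq_0D[where \<chi> = \<chi>, OF additive.zero[OF add]])
  qed
  then have "?L - ?R = 0" by (intro poly_eqI) (simp only: coeff_0)
  then show ?thesis by (rule right_minus_eq[THEN iffD1])
qed

end

text \<open>This transports the identity backwards along a homomorphism: a functional that factors through
  a quotient only sees the identity of the quotient.\<close>

lemma jacobi_at_comp:
  assumes "jacobi_at br act \<chi>" "additive \<chi>" "additive h"
    and "\<And>a m. map_poly h (act' a m) = act a (h m)"
    and "\<And>a m n. act a (m + n) = act a m + act a n"
  shows "jacobi_at br act' (\<lambda>m. \<chi> (h m))"
proof -
  have zero: "act a 0 = 0" for a
    using assms(5)[of a 0 0] by simp
  note zeros = additive.zero[OF assms(2)] additive.zero[OF assms(3)]
  have 1: "ev (\<lambda>m. \<chi> (h m)) (act' a m) x = ev \<chi> (act a (h m)) x" for a m x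
    by (simp add: zeros ev_map_poly flip: assms(4))
  have 2: "ev (\<lambda>n. ev \<chi> (act a (h n)) x) (act' b m) y = ev (\<lambda>n. ev \<chi> (act a n) x) (act b (h m)) y"
    for a b m x y
    unfolding assms(4)[symmetric] by (subst ev_map_poly) (simp_all add: zero zeros assms(4))
  show ?thesis unfolding jacobi_at_def 1 2 by (intro allI jacobi_atD[OF assms(1)])
qed

section \<open>The polynomial equations of an extension\<close>

lemma poly_ext:
  fixes p q :: "complex poly"
  assumes "\<And>x. poly p x = poly q x"
  shows "p = q"
  using assms by (intro poly_eq_poly_eq_iff[THEN iffD1] ext)

lemma poly_zeroI:
  fixes p :: "complex poly"
  assumes "\<And>x. poly p x = 0"
  shows "p = 0"
  using assms by (intro poly_ext) simp

text \<open>Specializing one variable determines \<open>g\<close>: \<open>x = 0\<close> gives \<open>\<gamma> g = 0\<close>; \<open>y = 0\<close> makes \<open>g\<close> constant if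
  \<open>a \<noteq> 1\<close>; for \<open>a = 1\<close> it gives \<open>g(0) = 0\<close>, and \<open>y = 1\<close> makes \<open>g\<close> linear.\<close>

lemma B_equation_solutions:
  fixes g :: "complex poly"
  assumes eq: "\<And>x y. (\<gamma> + y + \<alpha> * x) * poly g y = (y - (a - 1) * x) * poly g (x + y)"
    and "\<alpha> \<noteq> 0" "g \<noteq> 0"
  shows "\<gamma> = 0 \<and> (\<alpha> = 1 - a \<and> a \<noteq> 1 \<and> (\<exists>k. k \<noteq> 0 \<and> g = [:k:]) \<or>
    \<alpha> = 1 \<and> a = 1 \<and> (\<exists>k. k \<noteq> 0 \<and> g = [:0, k:]))"
proof -
  have "\<gamma> * poly g y = 0" for y
    using eq[where x = 0 and y = y] by (simp add: algebra_simps)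
  moreover obtain y where "poly g y \<noteq> 0"
    using \<open>g \<noteq> 0\<close> by (auto simp flip: poly_all_0_iff_0)
  ultimately have "\<gamma> = 0" by (metis mult_eq_0_iff)
  note eq = eq[unfolded \<open>\<gamma> = 0\<close>]
  show ?thesis
  proof (cases "a = 1")
    case True
    have g0: "poly g 0 = 0"
      using eq[where x = 1 and y = 0] \<open>\<alpha> \<noteq> 0\<close> True by simp
    define k where "k = poly g 1"
    have gx: "poly g x = (1 + \<alpha> * (x - 1)) * k" for x
      using eq[where x = "x - 1" and y = 1] True by (simp add: k_def)
    have "k \<noteq> 0"
      using gx \<open>g \<noteq> 0\<close> by (auto simp flip: poly_all_0_iff_0)
    with gx[of 0] g0 have "\<alpha> = 1" by simp
    moreover have "poly g x = poly [:0, k:] x" for x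
      using gx[of x] \<open>\<alpha> = 1\<close> by simp
    then have "g = [:0, k:]" by (rule poly_ext)
    ultimately show ?thesis using True \<open>\<gamma> = 0\<close> \<open>k \<noteq> 0\<close> by blast
  next
    case False
    define k where "k = \<alpha> * poly g 0 / (1 - a)"
    have "poly ([:0, 1:] * g) x = poly ([:0, 1:] * [:k:]) x" for x
      using eq[where x = x and y = 0] False by (simp add: k_def field_simps)
    then have "[:0, 1:] * g = [:0, 1:] * [:k:]"
      by (rule poly_ext)
    then have "g = [:k:]"
      by (simp only: mult_cancel_left) simp
    moreover from this have "k \<noteq> 0" using \<open>g \<noteq> 0\<close> by auto
    moreover from this \<open>g = [:k:]\<close> have "\<alpha> = 1 - a"
      using eq[where x = 1 and y = 0] by simp
    ultimately show ?thesis using False \<open>\<gamma> = 0\<close> by blast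
  qed
qed

lemma taylor_coeffs:
  fixes f :: "complex poly"
  shows "coeff (pcompose f [:x, 1:]) 0 = poly f x"
    and "coeff (pcompose f [:x, 1:]) 1 = poly (pderiv f) x"
    and "coeff (pcompose f [:x, 1:]) 2 = poly (pderiv (pderiv f)) x / 2"
    and "coeff (pcompose f [:x, 1:]) 3 = poly (pderiv (pderiv (pderiv f))) x / 6"
proof -
  define F where "F = pcompose f [:x, 1:]"
  have d: "pderiv (pcompose h [:x, 1:]) = pcompose (pderiv h) [:x, 1:]" for h :: "complex poly"
    by (simp add: pderiv_pcompose pderiv_pCons)
  have c: "coeff (pcompose h [:x, 1:]) 0 = poly h x" for h :: "complex poly"
    by (simp add: poly_pcompose flip: poly_0_coeff_0)
  show "coeff (pcompose f [:x, 1:]) 0 = poly f x" by (rule c)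
  show "coeff (pcompose f [:x, 1:]) 1 = poly (pderiv f) x"
    using c[of "pderiv f"] by (simp add: coeff_pderiv flip: d)
  show "coeff (pcompose f [:x, 1:]) 2 = poly (pderiv (pderiv f)) x / 2"
    using c[of "pderiv (pderiv f)"] by (simp add: coeff_pderiv numeral_2_eq_2 mult.commute flip: d)
  show "coeff (pcompose f [:x, 1:]) 3 = poly (pderiv (pderiv (pderiv f))) x / 6"
    using c[of "pderiv (pderiv (pderiv f))"] by (simp add: coeff_pderiv numeral_3_eq_3 mult.commute flip: d)
qed

text \<open>For fixed \<open>x\<close> both sides are polynomials in \<open>y\<close>, and the \<open>y\<close>-coefficients of \<open>f(x+y)\<close> are the
  Taylor coefficients of \<open>f\<close> at \<open>x\<close>. Comparing coefficients turns the functional equation into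
  linear differential equations for \<open>f\<close>; the inhomogeneity \<open>r x\<close> stands for \<open>Q(-x-y,x) g(x+y)\<close> as a
  polynomial in \<open>y\<close>.\<close>

lemma A_equation_taylor:
  fixes f :: "complex poly"
  assumes eq: "\<And>x y. (x + \<alpha> * y) * poly f x - (y + \<alpha> * x) * poly f y =
      (x - y) * poly f (x + y) + poly (r x) y"
  shows "coeff (r x) 0 = - \<alpha> * coeff f 0 * x"
    and "coeff (r x) 1 = (\<alpha> + 1) * poly f x - coeff f 0 - \<alpha> * coeff f 1 * x - x * poly (pderiv f) x"
    and "coeff (r x) 2 = poly (pderiv f) x - coeff f 1 - \<alpha> * coeff f 2 * x
      - x * poly (pderiv (pderiv f)) x / 2"
    and "coeff (r x) 3 = poly (pderiv (pderiv f)) x / 2 - coeff f 2 - \<alpha> * coeff f 3 * x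
      - x * poly (pderiv (pderiv (pderiv f))) x / 6"
proof -
  have "poly ([:x, \<alpha>:] * [:poly f x:] - [:\<alpha> * x, 1:] * f - [:x, -1:] * pcompose f [:x, 1:]) y = poly (r x) y"
    for y using eq[of x y] by (simp add: poly_pcompose algebra_simps)
  then have r: "r x = [:x, \<alpha>:] * [:poly f x:] - [:\<alpha> * x, 1:] * f - [:x, -1:] * pcompose f [:x, 1:]"
    by (rule poly_ext[symmetric])
  note t = taylor_coeffs[of f x] taylor_coeffs(2-4)[of f x, unfolded numeral_2_eq_2 numeral_3_eq_3 One_nat_def]
  show "coeff (r x) 0 = - \<alpha> * coeff f 0 * x"
    by (simp add: r t algebra_simps)
  show "coeff (r x) 1 = (\<alpha> + 1) * poly f x - coeff f 0 - \<alpha> * coeff f 1 * x - x * poly (pderiv f) x"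
    by (simp add: r t algebra_simps)
  show "coeff (r x) 2 = poly (pderiv f) x - coeff f 1 - \<alpha> * coeff f 2 * x
      - x * poly (pderiv (pderiv f)) x / 2"
    by (simp add: r t numeral_2_eq_2 algebra_simps)
  show "coeff (r x) 3 = poly (pderiv (pderiv f)) x / 2 - coeff f 2 - \<alpha> * coeff f 3 * x
      - x * poly (pderiv (pderiv (pderiv f))) x / 6"
    by (simp add: r t numeral_2_eq_2 numeral_3_eq_3 algebra_simps)
qed

text \<open>For \<open>\<gamma> \<noteq> 0\<close> the specialization \<open>y = 0\<close> suffices. For \<open>\<gamma> = 0\<close> the \<open>y\<^sup>2\<close>-equation kills
  the \<open>x\<^sup>n\<close>-coefficient of \<open>f\<close> for \<open>n > 3\<close>, as it multiplies it by a nonzero multiple of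
  \<open>n(n-3)\<close>; the \<open>y\<^sup>1\<close>-equation multiplies it by \<open>\<alpha> + 1 - n\<close> for \<open>n \<ge> 2\<close>.\<close>

lemma homogeneous_A_equation_solutions:
  fixes f :: "complex poly"
  assumes eq: "\<And>x y. (\<gamma> + x + \<alpha> * y) * poly f x - (\<gamma> + y + \<alpha> * x) * poly f y = (x - y) * poly f (x + y)"
    and "\<alpha> \<noteq> 0"
  shows "(\<gamma> \<noteq> 0 \<longrightarrow> (\<exists>k. f = [:k * \<gamma>, k * \<alpha>:])) \<and>
    (\<gamma> = 0 \<longrightarrow> (\<exists>k s. f = [:0, k * \<alpha>:] \<or> \<alpha> = 1 \<and> f = [:0, k * \<alpha>:] + monom s 2 \<or>
      \<alpha> = 2 \<and> f = [:0, k * \<alpha>:] + monom s 3))"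
proof (intro conjI impI)
  assume "\<gamma> \<noteq> 0"
  have "poly f x = poly [:poly f 0 / \<gamma> * \<gamma>, poly f 0 / \<gamma> * \<alpha>:] x" for x
    using eq[of x 0] \<open>\<gamma> \<noteq> 0\<close> by (simp add: field_simps)
  then show "\<exists>k. f = [:k * \<gamma>, k * \<alpha>:]"
    by (intro exI[of _ "poly f 0 / \<gamma>"] poly_ext)
next
  assume "\<gamma> = 0"
  with eq have eq0: "(x + \<alpha> * y) * poly f x - (y + \<alpha> * x) * poly f y =
      (x - y) * poly f (x + y) + poly ((\<lambda>_. 0) x) y" for x y by simp
  note T = A_equation_taylor[OF eq0]
  have f0: "coeff f 0 = 0"
    using T(1)[of 1] \<open>\<alpha> \<noteq> 0\<close> by simp
  have "poly (smult (\<alpha> + 1) f - [:0, \<alpha> * coeff f 1:] - [:0, 1:] * pderiv f) x = 0" for x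
    using T(2)[of x] f0 by (simp add: algebra_simps)
  then have P1: "smult (\<alpha> + 1) f - [:0, \<alpha> * coeff f 1:] - [:0, 1:] * pderiv f = 0"
    by (rule poly_zeroI)
  have "poly (pderiv f - [:coeff f 1, \<alpha> * coeff f 2:] - smult (1/2) ([:0, 1:] * pderiv (pderiv f))) x = 0" for x
    using T(3)[of x] by (simp add: algebra_simps)
  then have P2: "pderiv f - [:coeff f 1, \<alpha> * coeff f 2:] - smult (1/2) ([:0, 1:] * pderiv (pderiv f)) = 0"
    by (rule poly_zeroI)
  have high: "coeff f n = 0" if "n > 3" for n
  proof -
    obtain m where m: "n = Suc (Suc (Suc m))" "m \<noteq> 0"
      using \<open>n > 3\<close> that[of "n - 3"] by simp
    have "(of_nat m + 3) * of_nat m * coeff f n = 0"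
      using arg_cong[OF P2, of "\<lambda>p. coeff p (Suc (Suc m))"] m(1)
      by (simp add: coeff_pderiv field_simps) (metis right_minus)
    moreover have "of_nat m + 3 \<noteq> (0 :: complex)"
      using of_nat_neq_0[of "m + 2", where ?'a = complex] by (simp add: algebra_simps)
    ultimately show ?thesis using m by simp
  qed
  have f: "f = [:0, coeff f 1, coeff f 2, coeff f 3:]"
  proof (rule poly_eqI)
    fix n show "coeff f n = coeff [:0, coeff f 1, coeff f 2, coeff f 3:] n"
    proof (cases "n > 3")
      case True
      then show ?thesis using high[of n] by (auto simp: coeff_pCons split: nat.splits)
    next
      case False
      then have "n = 0 \<or> n = 1 \<or> n = 2 \<or> n = 3" by auto
      then show ?thesis using f0 by (auto simp: numeral_2_eq_2 numeral_3_eq_3)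
    qed
  qed
  have f2: "coeff f 2 = 0 \<or> \<alpha> = 1"
    using arg_cong[OF P1, of "\<lambda>p. coeff p (Suc (Suc 0))"]
    by (simp add: coeff_pderiv numeral_2_eq_2 algebra_simps)
  have f3: "coeff f 3 = 0 \<or> \<alpha> = 2"
    using arg_cong[OF P1, of "\<lambda>p. coeff p (Suc (Suc (Suc 0)))"]
    by (simp add: coeff_pderiv numeral_3_eq_3 algebra_simps)
  define k where "k = coeff f 1 / \<alpha>"
  have k: "coeff f (Suc 0) = k * \<alpha>" using \<open>\<alpha> \<noteq> 0\<close> by (simp add: k_def)
  show "\<exists>k s. f = [:0, k * \<alpha>:] \<or> \<alpha> = 1 \<and> f = [:0, k * \<alpha>:] + monom s 2 \<or>
      \<alpha> = 2 \<and> f = [:0, k * \<alpha>:] + monom s 3"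
  proof (cases "\<alpha> = 1")
    case True
    with f3 f have "f = [:0, k * \<alpha>:] + monom (coeff f 2) 2"
      by (simp add: k monom_altdef numeral_2_eq_2)
    with True show ?thesis by blast
  next
    case False
    with f2 f3 f have "f = [:0, k * \<alpha>:] \<or> \<alpha> = 2 \<and> f = [:0, k * \<alpha>:] + monom (coeff f 3) 3"
      by (auto simp: k monom_altdef numeral_3_eq_3)
    then show ?thesis by blast
  qed
qed

text \<open>The parameters of \<open>Q\<close> are killed one after the other by low \<open>y\<close>-coefficients of
  \<open>Q(-x-y,x) g(x+y)\<close>: \<open>c\<close> if \<open>a = 1\<close>, \<open>d\<close> if \<open>a = 0\<close> and \<open>c\<close> if \<open>a = -1\<close> by \<open>y\<^sup>0\<close>; \<open>c\<close> if \<open>a = 0\<close> and \<open>d\<close> if \<open>a = -1\<close> by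
  \<open>y\<^sup>1\<close>. For \<open>a = -4\<close> and \<open>a = -6\<close> the \<open>y\<^sup>2\<close>-coefficient vanishes, which bounds the degree of \<open>f\<close>
  by 3, while the \<open>y\<^sup>3\<close>-coefficient would need a term of higher degree in \<open>f\<close>.\<close>

lemma A_equation_excludes_B:
  fixes f g :: "complex poly"
  assumes eq: "\<And>x y. (x + \<alpha> * y) * poly f x - (y + \<alpha> * x) * poly f y =
      (x - y) * poly f (x + y) + poly (poly Q [:x:]) (- x - y) * poly g (x + y)"
    and Q: "type_II_poly a Q"
    and g: "\<alpha> = 1 - a \<and> a \<noteq> 1 \<and> k \<noteq> 0 \<and> g = [:k:] \<or> \<alpha> = 1 \<and> a = 1 \<and> k \<noteq> 0 \<and> g = [:0, k:]"
  shows False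
proof -
  have "k \<noteq> 0" using g by auto
  have inhom: "(x + \<alpha> * y) * poly f x - (y + \<alpha> * x) * poly f y = (x - y) * poly f (x + y) + poly (r x) y"
    if "\<And>x y. poly (poly Q [:x:]) (- x - y) * poly g (x + y) = poly (r x) y" for r x y
    using eq[of x y] that[of x y] by simp
  \<comment> \<open>The common part of the cases \<open>a = -4\<close> (where \<open>n = 4\<close>) and \<open>a = -6\<close> (where \<open>n = 6\<close>): the
    \<open>x\<^sup>n\<close>-coefficient of the \<open>y\<^sup>3\<close>-equation involves only the \<open>x\<^bsup>n+2\<^esup>\<close>-coefficient of \<open>f\<close>.\<close>
  have high: False
    if r: "\<And>x y. poly (poly Q [:x:]) (- x - y) * poly g (x + y) = poly (r x) y"
      and r2: "\<And>x. coeff (r x) 2 = 0" and r3: "\<And>x. coeff (r x) 3 = l * x ^ n"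
      and "l \<noteq> 0" "n > 1" for r l n
  proof -
    note T = A_equation_taylor[OF inhom[OF r]]
    have "poly (pderiv f - [:coeff f 1, \<alpha> * coeff f 2:] - smult (1/2) ([:0, 1:] * pderiv (pderiv f))) x = 0" for x
      using T(3)[of x] r2[of x] by (simp add: algebra_simps)
    then have P2: "pderiv f - [:coeff f 1, \<alpha> * coeff f 2:] - smult (1/2) ([:0, 1:] * pderiv (pderiv f)) = 0"
      by (rule poly_zeroI)
    have "poly (smult (1/2) (pderiv (pderiv f)) - [:coeff f 2, \<alpha> * coeff f 3:]
        - smult (1/6) ([:0, 1:] * pderiv (pderiv (pderiv f)))) x = poly (monom l n) x" for x
      using T(4)[of x] r3[of x] by (simp add: poly_monom algebra_simps)
    then have P3: "smult (1/2) (pderiv (pderiv f)) - [:coeff f 2, \<alpha> * coeff f 3:]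
        - smult (1/6) ([:0, 1:] * pderiv (pderiv (pderiv f))) = monom l n"
      by (rule poly_ext)
    obtain m where m: "n = Suc (Suc m)"
      using \<open>n > 1\<close> that[of "n - 2"] by simp
    have "(of_nat m + 4) * (of_nat m + 1) * coeff f (Suc (Suc n)) = 0"
      using arg_cong[OF P2, of "\<lambda>p. coeff p (Suc n)"] m
      by (simp add: coeff_pderiv field_simps) (metis right_minus)
    moreover have "of_nat m + 4 \<noteq> (0 :: complex)" "of_nat m + 1 \<noteq> (0 :: complex)"
      using of_nat_neq_0[of "m + 3", where ?'a = complex] of_nat_neq_0[of m, where ?'a = complex]
      by (simp_all add: algebra_simps)
    ultimately have "coeff f (Suc (Suc n)) = 0" by simp
    then show False
      using arg_cong[OF P3, of "\<lambda>p. coeff p n"] m \<open>l \<noteq> 0\<close>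
      by (simp add: coeff_pderiv)
  qed
  from Q obtain c d where "Q \<noteq> 0" and cases:
     "(a = 1 \<and> Q = cst c * (pd + 2 * lam)) \<or>
     (a = 0 \<and> Q = cst c * (pd + 2 * lam) * (pd + lam) * lam + cst d * (pd + 2 * lam) * pd) \<or>
     (a = -1 \<and> Q = cst c * (pd + 2 * lam) * pd ^ 2
                   + cst d * (pd + 2 * lam) * (pd + lam) * pd * lam) \<or>
     (a = -4 \<and> Q = cst c * (pd + 2 * lam) * (pd + lam) ^ 3 * lam ^ 3) \<or>
     (a = -6 \<and> Q = cst c * (pd + 2 * lam) *
                   (11 * (pd + lam) ^ 4 * lam ^ 4 + 2 * (pd + lam) ^ 3 * pd ^ 2 * lam ^ 3))"
    unfolding type_II_poly_def by (elim conjE exE) (rule that)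
  from cases show False
  proof (elim disjE conjE)
    assume aQ: "a = 1" "Q = cst c * (pd + 2 * lam)"
    with g have 1: "Q = cst c * (pd + 2 * lam)" "\<alpha> = 1" "g = [:0, k:]" by auto
    have r: "poly (poly Q [:x:]) (- x - y) * poly g (x + y) =
        poly (smult (c * k) ([:x, -1:] * [:x, 1:])) y" for x y
      by (simp add: 1 algebra_simps)
    note T = A_equation_taylor(1)[OF inhom[OF r]]
    have "c * k = 0"
      using T[of 1] T[of "-1"] by simp
    with 1 \<open>Q \<noteq> 0\<close> \<open>k \<noteq> 0\<close> show False by simp
  next
    assume aQ: "a = 0" "Q = cst c * (pd + 2 * lam) * (pd + lam) * lam + cst d * (pd + 2 * lam) * pd"
    with g have 0: "Q = cst c * (pd + 2 * lam) * (pd + lam) * lam + cst d * (pd + 2 * lam) * pd"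
      "\<alpha> = 1" "g = [:k:]" by auto
    have r: "poly (poly Q [:x:]) (- x - y) * poly g (x + y) =
        poly (smult k ([:x, -1:] * (smult (- c * x) [:0, 1:] - smult d [:x, 1:]))) y" for x y
      by (simp add: 0 algebra_simps)
    note T = A_equation_taylor[OF inhom[OF r]]
    have d0: "k * d = 0" and f0: "coeff f 0 = 0"
      using T(1)[of 1] T(1)[of "-1"] 0 by (simp_all add: algebra_simps)
    have "poly (smult 2 f - [:0, coeff f 1:] - [:0, 1:] * pderiv f) x = poly [:0, 0, - c * k:] x" for x
      using T(2)[of x] d0 f0 \<open>k \<noteq> 0\<close> 0 by (simp add: algebra_simps)
    then have "smult 2 f - [:0, coeff f 1:] - [:0, 1:] * pderiv f = [:0, 0, - c * k:]"
      by (rule poly_ext)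
    from arg_cong[OF this, of "\<lambda>p. coeff p (Suc (Suc 0))"] have "c * k = 0"
      by (simp add: coeff_pderiv)
    with 0 d0 \<open>Q \<noteq> 0\<close> \<open>k \<noteq> 0\<close> show False by simp
  next
    assume aQ: "a = -1" "Q = cst c * (pd + 2 * lam) * pd ^ 2 + cst d * (pd + 2 * lam) * (pd + lam) * pd * lam"
    with g have m1: "Q = cst c * (pd + 2 * lam) * pd ^ 2 + cst d * (pd + 2 * lam) * (pd + lam) * pd * lam"
      "\<alpha> = 2" "g = [:k:]" by auto
    have r: "poly (poly Q [:x:]) (- x - y) * poly g (x + y) =
        poly (smult k ([:x, -1:] * [:x, 1:] * (smult c [:x, 1:] + smult (d * x) [:0, 1:]))) y" for x y
      by (simp add: m1 algebra_simps power2_eq_square)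
    note T = A_equation_taylor[OF inhom[OF r]]
    have c0: "k * c = 0" and f0: "coeff f 0 = 0"
      using T(1)[of 1] T(1)[of 2] m1 by (simp_all add: algebra_simps)
    have "poly (smult 3 f - [:0, 2 * coeff f 1:] - [:0, 1:] * pderiv f) x = poly [:0, 0, 0, d * k:] x" for x
      using T(2)[of x] c0 f0 \<open>k \<noteq> 0\<close> m1 by (simp add: algebra_simps)
    then have "smult 3 f - [:0, 2 * coeff f 1:] - [:0, 1:] * pderiv f = [:0, 0, 0, d * k:]"
      by (rule poly_ext)
    from arg_cong[OF this, of "\<lambda>p. coeff p (Suc (Suc (Suc 0)))"] have "d * k = 0"
      by (simp add: coeff_pderiv)
    with m1 c0 \<open>Q \<noteq> 0\<close> \<open>k \<noteq> 0\<close> show False by simp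
  next
    assume aQ: "a = -4" "Q = cst c * (pd + 2 * lam) * (pd + lam) ^ 3 * lam ^ 3"
    with g have m4: "Q = cst c * (pd + 2 * lam) * (pd + lam) ^ 3 * lam ^ 3" "g = [:k:]" by auto
    have r: "poly (poly Q [:x:]) (- x - y) * poly g (x + y) =
        poly (smult (- c * k * x ^ 3) ([:x, -1:] * monom 1 3)) y" for x y
      by (simp add: m4 poly_monom algebra_simps power3_eq_cube)
    show False
    proof (rule high[OF r])
      show "coeff (smult (- c * k * x ^ 3) ([:x, -1:] * monom 1 3)) 2 = 0" for x
        by (simp add: numeral_2_eq_2 numeral_3_eq_3 monom_Suc)
      show "coeff (smult (- c * k * x ^ 3) ([:x, -1:] * monom 1 3)) 3 = (- c * k) * x ^ 4" for x
        by (simp add: numeral_3_eq_3 monom_Suc power_Suc eval_nat_numeral)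
      show "- c * k \<noteq> 0" using m4 \<open>Q \<noteq> 0\<close> \<open>k \<noteq> 0\<close> by auto
    qed simp
  next
    assume aQ: "a = -6" "Q = cst c * (pd + 2 * lam) *
      (11 * (pd + lam) ^ 4 * lam ^ 4 + 2 * (pd + lam) ^ 3 * pd ^ 2 * lam ^ 3)"
    with g have m6: "Q = cst c * (pd + 2 * lam) *
      (11 * (pd + lam) ^ 4 * lam ^ 4 + 2 * (pd + lam) ^ 3 * pd ^ 2 * lam ^ 3)" "g = [:k:]" by auto
    have r: "poly (poly Q [:x:]) (- x - y) * poly g (x + y) =
        poly (smult (c * k * x ^ 3) ([:x, -1:] * monom 1 3 * ([:0, 11 * x:] - smult 2 ([:x, 1:] * [:x, 1:])))) y" for x y
      by (simp add: m6 poly_monom algebra_simps eval_nat_numeral)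
    show False
    proof (rule high[OF r])
      show "coeff (smult (c * k * x ^ 3) ([:x, -1:] * monom 1 3 * ([:0, 11 * x:] - smult 2 ([:x, 1:] * [:x, 1:])))) 2 = 0" for x
        by (simp add: numeral_2_eq_2 numeral_3_eq_3 monom_Suc)
      show "coeff (smult (c * k * x ^ 3) ([:x, -1:] * monom 1 3 * ([:0, 11 * x:] - smult 2 ([:x, 1:] * [:x, 1:])))) 3
          = (- 2 * c * k) * x ^ 6" for x
        by (simp add: numeral_3_eq_3 monom_Suc power_Suc eval_nat_numeral)
      show "- 2 * c * k \<noteq> 0" using m6 \<open>Q \<noteq> 0\<close> \<open>k \<noteq> 0\<close> by auto
    qed simp
  qed
qed

section \<open>Eigenfunctionals of conformal modules\<close>

text \<open>The axioms of a conformal module speak of \<open>\<partial>\<close> and of scalars only; these generate \<open>\<complex>[\<partial>]\<close>.\<close>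

lemma eigenfunctionalI:
  assumes "module s" "additive \<chi>"
    and "\<And>k m. \<chi> (scal s k m) = k * \<chi> m" "\<And>m. \<chi> (deriv_op s m) = z * \<chi> m"
  shows "eigenfunctional s z \<chi>"
proof -
  interpret module s by fact
  have "\<chi> (s r m) = poly r z * \<chi> m" for r m
  proof (induction r arbitrary: m)
    case 0 then show ?case using additive.zero[OF assms(2)] by simp
  next
    case (pCons k r)
    have "pCons k r = [:k:] + [:0, 1:] * r" by simp
    then have "s (pCons k r) m = scal s k m + deriv_op s (s r m)"
      by (simp only: scale_left_distrib scale_scale)
    then have "\<chi> (s (pCons k r) m) = k * \<chi> m + z * \<chi> (s r m)"
      by (simp only: additive.add[OF assms(2)] assms(3,4))
    then show ?case by (simp add: pCons.IH algebra_simps)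
  qed
  then show ?thesis using assms(2) by (simp add: eigenfunctional_def)
qed

context conformal_module
begin

lemma act_zero_left [simp]: "act 0 m = 0"
  using act_add_left[of 0 0 m] by simp

lemma act_zero_right [simp]: "act a 0 = 0"
  using act_add_right[of a 0 0] by simp

lemma eigenfunctional_act_right:
  assumes "eigenfunctional sV z \<chi>"
  shows "eigenfunctional sV (z + x) (\<lambda>m. ev \<chi> (act a m) x)"
proof (rule eigenfunctionalI[OF V.module_axioms])
  note add = eigenfunctional_additive[OF assms]
  note zero = additive.zero[OF add]
  show "additive (\<lambda>m. ev \<chi> (act a m) x)"
    by unfold_locales (simp add: act_add_right ev_add_poly[OF add])
  show "ev \<chi> (act a (scal sV k m)) x = k * ev \<chi> (act a m) x" for k m
    by (simp add: act_scal_right ev_map_poly[of \<chi>] zero eigenfunctional_smul[OF assms] ev_mult_fun[of \<chi>])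
  show "ev \<chi> (act a (deriv_op sV m)) x = (z + x) * ev \<chi> (act a m) x" for m
    by (simp add: act_deriv_right ev_add_poly[OF add] ev_pCons[OF add] ev_map_poly[of \<chi>] zero
        eigenfunctional_smul[OF assms] ev_mult_fun[of \<chi>] algebra_simps)
qed

lemma eigenfunctional_act_left:
  assumes "eigenfunctional sV z \<chi>"
  shows "eigenfunctional sR (- x) (\<lambda>a. ev \<chi> (act a m) x)"
proof (rule eigenfunctionalI[OF module_axioms])
  note add = eigenfunctional_additive[OF assms]
  note zero = additive.zero[OF add]
  show "additive (\<lambda>a. ev \<chi> (act a m) x)"
    by unfold_locales (simp add: act_add_left ev_add_poly[OF add])
  show "ev \<chi> (act (scal sR k a) m) x = k * ev \<chi> (act a m) x" for k a
    by (simp add: act_scal_left ev_map_poly[of \<chi>] zero eigenfunctional_smul[OF assms] ev_mult_fun[of \<chi>])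
  show "ev \<chi> (act (deriv_op sR a) m) x = - x * ev \<chi> (act a m) x" for a
    by (simp add: act_deriv_left additive.minus[OF additive_ev[OF add]] ev_pCons[OF add] zero
        del: minus_pCons)
qed

lemma jacobi_at_act: "additive \<chi> \<Longrightarrow> jacobi_at br act \<chi>"
  by (rule jacobi_at_of_jacobi[OF act_add_left act_add_right act_jacobi])

end

lemma (in lie_conformal_algebra) adjoint_module: "conformal_module sR br sR br"
  by unfold_locales
    (fact br_add_left br_add_right br_scal_left br_scal_right br_deriv_left br_deriv_right br_jacobi)+

lemma coeff_papp: "module s \<Longrightarrow> coeff (papp s P m) n = s (coeff P n) m"
  by (simp add: papp_def coeff_map_poly module.scale_zero_left)


section \<open>The algebra and the two modules in coordinates\<close>

text \<open>Choosing coordinates with respect to \<open>{A, B}\<close>, \<open>v\<close> and \<open>c\<close> turns evaluation of a coordinate at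
  \<open>\<partial> = z\<close> into an eigenfunctional.\<close>

locale type_II_data =
  fixes sR :: "complex poly \<Rightarrow> 'r::ab_group_add \<Rightarrow> 'r"
    and br :: "'r \<Rightarrow> 'r \<Rightarrow> 'r poly"
    and A B :: 'r and a :: complex and Q :: "complex poly poly"
    and \<alpha> \<beta> \<eta> :: complex
    and sV :: "complex poly \<Rightarrow> 'v::ab_group_add \<Rightarrow> 'v" and aV :: "'r \<Rightarrow> 'v \<Rightarrow> 'v poly" and v :: 'v
    and sC :: "complex poly \<Rightarrow> 'c::ab_group_add \<Rightarrow> 'c" and aC :: "'r \<Rightarrow> 'c \<Rightarrow> 'c poly" and c :: 'c
  assumes R: "type_II_algebra sR br A B a Q"
    and V: "irreducible_V sR br A B \<alpha> \<beta> sV aV v"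
    and C: "one_dim_module sR br \<eta> sC aC c"
begin

lemma LCA: "lie_conformal_algebra sR br"
  and A_neq_B: "A \<noteq> B"
  and indep_AB: "\<not> module.dependent sR {A, B}" and span_AB: "module.span sR {A, B} = UNIV"
  and Q: "type_II_poly a Q"
  and br_A_A: "br A A = papp sR (pd + 2 * lam) A + papp sR Q B"
  and br_A_B: "br A B = papp sR (pd + cst a * lam) B"
  and br_B_B: "br B B = 0"
  using R unfolding type_II_algebra_def by blast+

lemma CV: "conformal_module sR br sV aV"
  and indep_v: "\<not> module.dependent sV {v}" and span_v: "module.span sV {v} = UNIV"
  and \<alpha>: "\<alpha> \<noteq> 0"
  and aV_A: "aV A v = papp sV (pd + cst \<alpha> * lam + cst \<beta>) v" and aV_B: "aV B v = 0"
  using V unfolding irreducible_V_def by blast+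

lemma CC: "conformal_module sR br sC aC" and c: "c \<noteq> 0" and c_spans: "\<exists>k. x = scal sC k c"
  and deriv_c: "deriv_op sC c = scal sC \<eta> c" and aC_c: "aC b c = 0"
  using C unfolding one_dim_module_def by blast+

sublocale LC: lie_conformal_algebra sR br by (rule LCA)
sublocale RM: conformal_module sR br sR br by (rule LC.adjoint_module)
sublocale VM: conformal_module sR br sV aV by (rule CV)
sublocale CM: conformal_module sR br sC aC by (rule CC)

definition "coordA r = module.representation sR {A, B} r A"
definition "coordB r = module.representation sR {A, B} r B"
definition "coordv w = module.representation sV {v} w v"
definition "coordc x = (SOME k. x = scal sC k c)"

lemma coordA_add: "coordA (r + r') = coordA r + coordA r'"
  and coordA_smul: "coordA (sR P r) = P * coordA r"
  and coordA_A: "coordA A = 1" and coordA_B: "coordA B = 0"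
  unfolding coordA_def using indep_AB span_AB A_neq_B
  by (simp_all add: LC.representation_add LC.representation_scale LC.representation_basis)

lemma expand_R: "r = sR (coordA r) A + sR (coordB r) B"
  using LC.sum_representation_eq[OF indep_AB, of r "{A, B}"] span_AB A_neq_B
  by (simp add: coordA_def coordB_def)

lemma coordv_add: "coordv (w + w') = coordv w + coordv w'"
  and coordv_smul: "coordv (sV P w) = P * coordv w"
  and coordv_v: "coordv v = 1"
  unfolding coordv_def using indep_v span_v
  by (simp_all add: VM.V.representation_add VM.V.representation_scale VM.V.representation_basis)

lemma expand_V: "w = sV (coordv w) v"
  using VM.V.sum_representation_eq[OF indep_v, of w "{v}"] span_v
  by (simp add: coordv_def)

lemma coordv_zero [simp]: "coordv 0 = 0"
  using coordv_add[of 0 0] by simp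

lemma expand_C: "x = scal sC (coordc x) c"
  unfolding coordc_def by (rule someI_ex[OF c_spans])

lemma scal_c_inject: "scal sC k c = scal sC l c \<longleftrightarrow> k = l"
proof
  assume eq: "scal sC k c = scal sC l c"
  have "scal sC (k - l) c = scal sC k c - scal sC l c"
    by (simp flip: CM.V.scale_left_diff_distrib)
  with eq have 0: "scal sC (k - l) c = 0" by simp
  show "k = l"
  proof (rule ccontr)
    assume "k \<noteq> l"
    then have "c = scal sC (1 / (k - l)) (scal sC (k - l) c)"
      by (simp add: CM.V.scale_scale flip: one_pCons)
    with 0 c show False by simp
  qed
qed simp

lemma coordc_scal: "coordc (scal sC k c) = k"
  using expand_C[of "scal sC k c"] by (simp add: scal_c_inject)

lemma coordc_c [simp]: "coordc c = 1"
  using coordc_scal[of 1] by (simp flip: one_pCons)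

lemma aC_zero [simp]: "aC b x = 0"
  by (subst expand_C) (simp add: CM.act_scal_right aC_c)

lemma eigenfunctional_coordA: "eigenfunctional sR z (\<lambda>r. poly (coordA r) z)"
  and eigenfunctional_coordv: "eigenfunctional sV z (\<lambda>w. poly (coordv w) z)"
  by (auto simp: eigenfunctional_def additive_def coordA_add coordA_smul coordv_add coordv_smul)

lemma eigenfunctional_coordc: "eigenfunctional sC \<eta> coordc"
proof (rule eigenfunctionalI[OF CM.V.module_axioms])
  have "scal sC (coordc x + coordc y) c = scal sC (coordc x) c + scal sC (coordc y) c" for x y
    by (simp flip: CM.V.scale_left_distrib)
  then have "coordc (x + y) = coordc x + coordc y" for x y
    using coordc_scal[of "coordc x + coordc y"] by (simp flip: expand_C)
  then show "additive coordc" by unfold_locales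
  show "coordc (scal sC k x) = k * coordc x" for k x
    by (subst expand_C[of x]) (simp add: CM.V.scale_scale coordc_scal mult.commute)
  show "coordc (deriv_op sC x) = \<eta> * coordc x" for x
  proof -
    have "deriv_op sC x = scal sC (coordc x) (deriv_op sC c)"
      by (subst expand_C[of x]) (simp only: CM.V.scale_scale mult.commute)
    also have "\<dots> = scal sC (\<eta> * coordc x) c"
      by (simp add: deriv_c CM.V.scale_scale mult.commute)
    finally show ?thesis by (simp add: coordc_scal)
  qed
qed

lemma smul_scal_c: "sC P (scal sC k c) = scal sC (poly P \<eta> * k) c"
  by (subst expand_C) (simp add: eigenfunctional_smul[OF eigenfunctional_coordc] mult.commute)

text \<open>Sesquilinearity in the first argument: the coordinates of \<open>r\<close> are evaluated at \<open>\<partial> = -x\<close>.\<close>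

lemma ev_act_R:
  assumes "conformal_module sR br sM aM" "eigenfunctional sM z \<chi>"
  shows "ev \<chi> (aM r m) x =
    poly (coordA r) (- x) * ev \<chi> (aM A m) x + poly (coordB r) (- x) * ev \<chi> (aM B m) x"
proof -
  interpret M: conformal_module sR br sM aM by fact
  note e = M.eigenfunctional_act_left[OF assms(2), of x m]
  show ?thesis
    by (subst expand_R[of r])
      (simp only: additive.add[OF eigenfunctional_additive[OF e]] eigenfunctional_smul[OF e])
qed

lemma ev_aV:
  "ev (\<lambda>w. poly (coordv w) z) (aV r w) x =
    poly (coordA r) (- x) * poly (coordv w) (z + x) * (z + \<alpha> * x + \<beta>)"
proof -
  note e = eigenfunctional_coordv[of z]
  have "ev (\<lambda>w. poly (coordv w) z) (aV b w) x =
      poly (coordv w) (z + x) * ev (\<lambda>w. poly (coordv w) z) (aV b v) x" for b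
    by (subst expand_V[of w]) (rule eigenfunctional_smul[OF VM.eigenfunctional_act_right[OF e]])
  note r = this
  show ?thesis
    unfolding ev_act_R[OF CV e, of r w x] unfolding r
    by (simp add: aV_A aV_B ev_papp[OF VM.V.module_axioms e] coordv_v algebra_simps)
qed

text \<open>The span of \<open>B\<close> is an abelian ideal, so only \<open>[A\<^sub>\<lambda>A]\<close> has an \<open>A\<close>-coordinate; for \<open>[B\<^sub>\<lambda>A]\<close> this needs
  skew-symmetry.\<close>

lemma ev_br:
  "ev (\<lambda>r. poly (coordA r) z) (br r s) x =
    poly (coordA r) (- x) * poly (coordA s) (z + x) * (z + 2 * x)"
proof -
  note e = eigenfunctional_coordA[of z]
  note p = ev_papp[OF LC.module_axioms e]
  have r: "ev (\<lambda>r. poly (coordA r) z) (br b s) x =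
      poly (coordA s) (z + x) * ev (\<lambda>r. poly (coordA r) z) (br b A) x
      + poly (coordB s) (z + x) * ev (\<lambda>r. poly (coordA r) z) (br b B) x" for b
  proof -
    note e' = RM.eigenfunctional_act_right[OF e, of x b]
    show ?thesis
      by (subst expand_R[of s])
        (simp only: additive.add[OF eigenfunctional_additive[OF e']] eigenfunctional_smul[OF e'])
  qed
  have AA: "ev (\<lambda>r. poly (coordA r) z) (br A A) x = z + 2 * x"
    by (simp add: br_A_A ev_add_poly[OF eigenfunctional_additive[OF e]] p coordA_A coordA_B)
  have AB: "ev (\<lambda>r. poly (coordA r) z) (br A B) y = 0" for y
    by (simp add: br_A_B p coordA_B)
  have BA: "ev (\<lambda>r. poly (coordA r) z) (br B A) x = 0"
    unfolding LC.br_skew[of B A] additive.minus[OF additive_ev[OF eigenfunctional_additive[OF e]]]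
      ev_subst_skew[OF LC.module_axioms e] AB by simp
  show ?thesis
    unfolding ev_act_R[OF RM.conformal_module_axioms e, of r s x] unfolding r AA AB BA
    by (simp add: br_B_B algebra_simps)
qed

text \<open>The \<open>c\<close>-coordinate of the map \<open>R \<otimes> V \<rightarrow> \<complex>c[\<lambda>]\<close> with value \<open>f(\<lambda>)c\<close> at \<open>(A, v)\<close> and \<open>0\<close> at \<open>(B, v)\<close>.
  Sesquilinearity forces this formula: \<open>\<partial>\<close> in the first argument becomes \<open>-\<lambda>\<close>, in the second
  \<open>\<partial> + \<lambda>\<close>, and \<open>\<partial>c = \<eta>c\<close>.\<close>

definition cocycle :: "complex poly \<Rightarrow> 'r \<Rightarrow> 'v \<Rightarrow> complex poly" where
  "cocycle f r w = pcompose (coordA r) [:0, -1:] * pcompose (coordv w) [:\<eta>, 1:] * f"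

lemma poly_cocycle:
  "poly (cocycle f r w) x = poly (coordA r) (- x) * poly f x * poly (coordv w) (\<eta> + x)"
  by (simp add: cocycle_def poly_pcompose)

lemma cocycle_A_v [simp]: "cocycle f A v = f"
  by (simp add: cocycle_def coordA_A coordv_v pcompose_1)

lemma cocycle_B [simp]: "cocycle f B w = 0"
  by (simp add: cocycle_def coordA_B)

definition A_equation :: "complex poly \<Rightarrow> bool" where
  "A_equation f \<longleftrightarrow> (\<forall>x y. (\<beta> + \<eta> + x + \<alpha> * y) * poly f x - (\<beta> + \<eta> + y + \<alpha> * x) * poly f y
      = (x - y) * poly f (x + y))"

text \<open>Each of the three terms is the same product of coordinates times a term of the equation for \<open>f\<close>.\<close>

lemma cocycle_jacobi:
  assumes "A_equation f"
  shows "ev (\<lambda>w. poly (cocycle f r w) x) (aV s w) y =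
    ev (\<lambda>r. poly (cocycle f r w) (x + y)) (br r s) x + ev (\<lambda>w. poly (cocycle f s w) y) (aV r w) x"
proof -
  have zv: "poly (coordv 0) z = 0" and zA: "poly (coordA 0) z = 0" for z
    by (simp_all add: additive.zero[OF eigenfunctional_additive[OF eigenfunctional_coordA]])
  have w: "ev (\<lambda>w. poly (cocycle f r w) x) q y =
      poly (coordA r) (- x) * poly f x * ev (\<lambda>w. poly (coordv w) (\<eta> + x)) q y" for r x q y
    unfolding poly_cocycle by (rule ev_mult_fun[where \<chi> = "\<lambda>w. poly (coordv w) (\<eta> + x)", OF zv])
  have r: "ev (\<lambda>r. poly (cocycle f r w) (x + y)) q x =
      poly f (x + y) * poly (coordv w) (\<eta> + x + y) * ev (\<lambda>r. poly (coordA r) (- x - y)) q x" for q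
  proof -
    have "(\<lambda>r. poly (cocycle f r w) (x + y)) =
        (\<lambda>r. poly f (x + y) * poly (coordv w) (\<eta> + x + y) * poly (coordA r) (- x - y))"
      by (simp add: poly_cocycle algebra_simps)
    then show ?thesis
      by (simp only: ev_mult_fun[where \<chi> = "\<lambda>r. poly (coordA r) (- x - y)", OF zA])
  qed
  have eq: "(\<eta> + x + \<alpha> * y + \<beta>) * poly f x =
      (x - y) * poly f (x + y) + (\<eta> + y + \<alpha> * x + \<beta>) * poly f y"
    using assms[unfolded A_equation_def, rule_format, of x y] by (simp add: algebra_simps)
  define K where "K = poly (coordA r) (- x) * poly (coordA s) (- y) * poly (coordv w) (\<eta> + x + y)"
  have "ev (\<lambda>w. poly (cocycle f r w) x) (aV s w) y = K * ((\<eta> + x + \<alpha> * y + \<beta>) * poly f x)"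
    unfolding w ev_aV K_def by (simp add: algebra_simps)
  moreover have "ev (\<lambda>w. poly (cocycle f s w) y) (aV r w) x = K * ((\<eta> + y + \<alpha> * x + \<beta>) * poly f y)"
    unfolding w ev_aV K_def by (simp add: algebra_simps)
  moreover have "ev (\<lambda>r. poly (cocycle f r w) (x + y)) (br r s) x = K * ((x - y) * poly f (x + y))"
    unfolding r ev_br K_def by (simp add: algebra_simps)
  ultimately show ?thesis unfolding eq by (simp only: distrib_left)
qed

end

section \<open>Extensions and their cocycles\<close>

text \<open>An extension together with a lift \<open>u\<close> of the generator \<open>v\<close>. The lift splits the extension over
  \<open>\<complex>[\<partial>]\<close>, since \<open>v\<close> is a free generator.\<close>

locale type_II_extension = type_II_data sR br A B a Q \<alpha> \<beta> \<eta> sV aV v sC aC c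
  for sR :: "complex poly \<Rightarrow> 'r::ab_group_add \<Rightarrow> 'r"
    and br :: "'r \<Rightarrow> 'r \<Rightarrow> 'r poly"
    and A B :: 'r and a :: complex and Q :: "complex poly poly"
    and \<alpha> \<beta> \<eta> :: complex
    and sV :: "complex poly \<Rightarrow> 'v::ab_group_add \<Rightarrow> 'v" and aV :: "'r \<Rightarrow> 'v \<Rightarrow> 'v poly" and v :: 'v
    and sC :: "complex poly \<Rightarrow> 'c::ab_group_add \<Rightarrow> 'c" and aC :: "'r \<Rightarrow> 'c \<Rightarrow> 'c poly" and c :: 'c +
  fixes sE :: "complex poly \<Rightarrow> 'e::ab_group_add \<Rightarrow> 'e" and aE :: "'r \<Rightarrow> 'e \<Rightarrow> 'e poly"
    and i :: "'c \<Rightarrow> 'e" and p :: "'e \<Rightarrow> 'v" and u :: 'e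
  assumes ext: "extension sR br sC aC sV aV sE aE i p"
    and p_u: "p u = v"
begin

lemma CE: "conformal_module sR br sE aE"
  and i_act: "aE b (i x) = map_poly i (aC b x)"
  and p_act: "aV b (p e) = map_poly p (aE b e)"
  and inj_i: "inj i" and range_i: "range i = {x. p x = 0}" and surj_p: "surj p"
  using ext unfolding extension_def conformal_hom_def by blast+

sublocale EM: conformal_module sR br sE aE by (rule CE)
sublocale i: module_hom sC sE i
  using ext unfolding extension_def conformal_hom_def by blast
sublocale p: module_hom sE sV p
  using ext unfolding extension_def conformal_hom_def by blast

lemma p_i [simp]: "p (i x) = 0"
  using range_i by blast

lemma aE_i [simp]: "aE b (i x) = 0"
  by (simp add: i_act)

text \<open>The \<open>c\<close>-coordinate with respect to this splitting.\<close>

definition "coordE e = coordc (inv i (e - sE (coordv (p e)) u))"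

lemma expand_E: "e = scal sE (coordE e) (i c) + sE (coordv (p e)) u"
proof -
  have "p (e - sE (coordv (p e)) u) = 0"
    by (simp add: p.diff p.scale p_u flip: expand_V)
  then have "e - sE (coordv (p e)) u \<in> range i" by (simp add: range_i)
  then have "e - sE (coordv (p e)) u = i (inv i (e - sE (coordv (p e)) u))"
    by (simp add: f_inv_into_f)
  also have "\<dots> = scal sE (coordE e) (i c)"
    unfolding coordE_def by (subst expand_C) (simp only: i.scale)
  finally show ?thesis by (simp add: algebra_simps)
qed

lemma coordE_eqI:
  assumes "e = i x + sE P u"
  shows "coordE e = coordc x"
proof -
  have "p e = sV P v" by (simp add: assms p.add p.scale p_u)
  then have "coordv (p e) = P" by (simp add: coordv_smul coordv_v)
  then show ?thesis by (simp add: coordE_def assms inv_f_f inj_i)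
qed

lemma coordE_i [simp]: "coordE (i x) = coordc x"
  by (rule coordE_eqI[of _ _ 0]) simp

lemma coordE_u [simp]: "coordE u = 0"
  using coordE_eqI[of u 0 1] coordc_scal[of 0] by simp

text \<open>The splitting is \<open>\<complex>[\<partial>]\<close>-linear and \<open>\<partial>\<close> acts by \<open>\<eta>\<close> on \<open>\<complex>c\<close>.\<close>

lemma eigenfunctional_coordE: "eigenfunctional sE \<eta> coordE"
proof -
  note e = eigenfunctional_coordc
  have 1: "e = i (scal sC (coordE e) c) + sE (coordv (p e)) u" for e
    by (subst expand_E) (simp only: i.scale)
  have "coordE (x + y) = coordE x + coordE y" for x y
  proof -
    have "x + y = i (scal sC (coordE x) c + scal sC (coordE y) c) + sE (coordv (p x) + coordv (p y)) u"
      by (subst 1[of x], subst 1[of y]) (simp add: i.add EM.V.scale_left_distrib)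
    from coordE_eqI[OF this] show ?thesis
      by (simp add: additive.add[OF eigenfunctional_additive[OF e]] coordc_scal)
  qed
  moreover have "coordE (sE P x) = poly P \<eta> * coordE x" for P x
  proof -
    have "sE P x = i (sC P (scal sC (coordE x) c)) + sE (P * coordv (p x)) u"
      by (subst 1[of x]) (simp only: i.scale EM.V.scale_right_distrib EM.V.scale_scale)
    from coordE_eqI[OF this] show ?thesis
      by (simp only: smul_scal_c coordc_scal)
  qed
  ultimately show ?thesis by (simp add: eigenfunctional_def additive_def)
qed

lemmas additive_coordE = eigenfunctional_additive[OF eigenfunctional_coordE]

lemma coordE_zero [simp]: "coordE 0 = 0"
  by (rule additive.zero[OF additive_coordE])

lemma eigenfunctional_coordv_p: "eigenfunctional sE z (\<lambda>e. poly (coordv (p e)) z)"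
  by (simp add: eigenfunctional_def additive_def p.add p.scale coordv_add coordv_smul)

lemma E_separated:
  assumes "coordE e = 0" "\<And>z. poly (coordv (p e)) z = 0"
  shows "e = 0"
proof -
  have "coordv (p e) = 0" using assms(2) by (rule poly_zeroI)
  then show ?thesis using expand_E[of e] assms(1) by simp
qed

abbreviation j :: "complex \<Rightarrow> 'e" where "j k \<equiv> scal sE k (i c)"

lemma j_eq: "j k = i (scal sC k c)"
  by (simp add: i.scale)

lemma additive_j: "additive j"
  by unfold_locales (simp flip: EM.V.scale_left_distrib)

lemma j_zero [simp]: "j 0 = 0"
  by simp

lemma coordE_j [simp]: "coordE (j k) = k"
  by (simp add: j_eq coordc_scal)

lemma p_j [simp]: "p (j k) = 0"
  by (simp add: j_eq)

lemma aE_j [simp]: "aE b (j k) = 0"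
  by (simp add: j_eq)

lemma deriv_j: "deriv_op sE (j k) = j (\<eta> * k)"
proof -
  have "deriv_op sC (scal sC k c) = scal sC k (deriv_op sC c)"
    by (simp only: CM.V.scale_scale mult.commute)
  then show ?thesis
    by (simp add: j_eq deriv_c CM.V.scale_scale mult.commute flip: i.scale)
qed

text \<open>The polynomials \<open>f\<close> and \<open>g\<close> of the standard form.\<close>

definition "cocA = map_poly coordE (aE A u)"
definition "cocB = map_poly coordE (aE B u)"

lemma poly_cocA: "poly cocA x = ev coordE (aE A u) x"
  and poly_cocB: "poly cocB x = ev coordE (aE B u) x"
  by (simp_all add: cocA_def cocB_def ev_def)

text \<open>The \<open>u\<close>-coordinate of the action is the action on the quotient.\<close>

lemma aE_expand: "aE b e = papp sE (map_poly coordv (aV b (p e))) u + map_poly j (map_poly coordE (aE b e))"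
  (is "?L = ?R")
proof (rule poly_eqI)
  fix n
  have "coeff ?R n = sE (coordv (coeff (aV b (p e)) n)) u + j (coordE (coeff (aE b e) n))"
    by (simp add: coeff_papp[OF EM.V.module_axioms] coeff_map_poly)
  also have "coeff (aV b (p e)) n = p (coeff (aE b e) n)"
    by (simp add: p_act coeff_map_poly)
  finally show "coeff ?L n = coeff ?R n"
    using expand_E[of "coeff (aE b e) n"] by (simp add: add.commute)
qed

lemma map_coordv_papp: "map_poly coordv (papp sV P v) = P"
  by (rule poly_eqI) (simp add: coeff_map_poly coeff_papp[OF VM.V.module_axioms] coordv_smul coordv_v)

lemma aE_A: "aE A u = papp sE (pd + cst \<alpha> * lam + cst \<beta>) u + map_poly j cocA"
  using aE_expand[of A u] by (simp only: p_u aV_A map_coordv_papp cocA_def)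

lemma aE_B: "aE B u = map_poly j cocB"
  using aE_expand[of B u] by (simp add: p_u aV_B cocB_def papp_def)

lemma map_coordE_papp: "map_poly coordE (papp sE P u) = 0"
  by (rule poly_eqI)
    (simp add: coeff_map_poly coeff_papp[OF EM.V.module_axioms] eigenfunctional_smul[OF eigenfunctional_coordE])

lemma map_coordE_j: "map_poly coordE (map_poly j f) = f"
  by (simp add: map_poly_map_poly comp_def)

lemma standard_form_iff: "standard_form sE aE A B \<alpha> \<beta> \<eta> (i c) u f g \<longleftrightarrow> f = cocA \<and> g = cocB"
proof
  assume s: "standard_form sE aE A B \<alpha> \<beta> \<eta> (i c) u f g"
  have "cocA = map_poly coordE (papp sE (pd + cst \<alpha> * lam + cst \<beta>) u + map_poly j f)"
    using s unfolding standard_form_def cocA_def by (elim conjE) (rule arg_cong)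
  also have "\<dots> = f"
    unfolding map_poly_plus[OF additive_coordE] map_coordE_papp map_coordE_j by simp
  finally have f: "f = cocA" by (rule sym)
  have "cocB = map_poly coordE (map_poly j g)"
    using s unfolding standard_form_def cocB_def by (elim conjE) (rule arg_cong)
  then show "f = cocA \<and> g = cocB" using f by (simp only: map_coordE_j)
next
  assume fg: "f = cocA \<and> g = cocB"
  have "\<exists>!z. x = j (fst z) + sE (snd z) u" for x
  proof (rule ex1I)
    show "x = j (fst (coordE x, coordv (p x))) + sE (snd (coordE x, coordv (p x))) u"
      using expand_E[of x] by simp
    fix z assume z: "x = j (fst z) + sE (snd z) u"
    then have "coordE x = fst z"
      using coordE_eqI[of x "scal sC (fst z) c" "snd z"] by (simp add: i.scale coordc_scal)
    moreover have "coordv (p x) = snd z"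
      by (simp add: z p.add p.scale p_u coordv_smul coordv_v)
    ultimately show "z = (coordE x, coordv (p x))" by (simp add: prod_eq_iff)
  qed
  moreover have "deriv_op sE (i c) = scal sE \<eta> (i c)"
    using deriv_j[of 1] by (simp flip: one_pCons)
  ultimately show "standard_form sE aE A B \<alpha> \<beta> \<eta> (i c) u f g"
    unfolding standard_form_def using fg aE_A aE_B aE_i by blast
qed

lemma ev_aE_u:
  assumes "eigenfunctional sE z \<chi>"
  shows "ev \<chi> (aE A u) y = (z + \<alpha> * y + \<beta>) * \<chi> u + \<chi> (i c) * poly cocA y"
    and "ev \<chi> (aE B u) y = \<chi> (i c) * poly cocB y"
proof -
  note add = eigenfunctional_additive[OF assms]
  have j: "ev \<chi> (map_poly j f) y = \<chi> (i c) * poly f y" for f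
  proof -
    have "ev \<chi> (map_poly j f) y = ev (\<lambda>k. \<chi> (i c) * k) f y"
      by (simp add: ev_map_poly[of \<chi>] additive.zero[OF add] eigenfunctional_smul[OF assms] mult.commute)
    then show ?thesis by (simp add: ev_mult_fun[of "\<lambda>k. k"])
  qed
  show "ev \<chi> (aE A u) y = (z + \<alpha> * y + \<beta>) * \<chi> u + \<chi> (i c) * poly cocA y"
    unfolding aE_A ev_add_poly[OF add] j ev_papp[OF EM.V.module_axioms assms] by (simp add: mult.commute)
  show "ev \<chi> (aE B u) y = \<chi> (i c) * poly cocB y"
    unfolding aE_B by (rule j)
qed

text \<open>The term \<open>A\<^sub>\<lambda>(B\<^sub>\<mu>u)\<close> drops out, because \<open>B\<^sub>\<mu>u\<close> lies in \<open>\<complex>c[\<mu>]\<close>.\<close>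

lemma B_equation:
  "(\<beta> + \<eta> + y + \<alpha> * x) * poly cocB y = (y - (a - 1) * x) * poly cocB (x + y)"
proof -
  note e = eigenfunctional_coordE
  note J = jacobi_atD[OF EM.jacobi_at_act[OF additive_coordE], of A x B u y]
  show ?thesis
    using J
    unfolding ev_aE_u[OF EM.eigenfunctional_act_right[OF e]] br_A_B
      ev_papp[OF LC.module_axioms EM.eigenfunctional_act_left[OF e]] aE_i
    by (simp add: poly_cocB algebra_simps)
qed

lemma A_B_equation:
  "(\<beta> + \<eta> + x + \<alpha> * y) * poly cocA x - (\<beta> + \<eta> + y + \<alpha> * x) * poly cocA y =
    (x - y) * poly cocA (x + y) + poly (poly Q [:x:]) (- x - y) * poly cocB (x + y)"
proof -
  note e = eigenfunctional_coordE
  note e' = EM.eigenfunctional_act_left[OF e]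
  note J = jacobi_atD[OF EM.jacobi_at_act[OF additive_coordE], of A x A u y]
  show ?thesis
    using J
    unfolding ev_aE_u[OF EM.eigenfunctional_act_right[OF e]] br_A_A
      ev_add_poly[OF eigenfunctional_additive[OF e']] ev_papp[OF LC.module_axioms e'] aE_i
    by (simp add: poly_cocA poly_cocB algebra_simps)
qed

lemma cocB_zero: "cocB = 0"
proof (rule ccontr)
  assume "cocB \<noteq> 0"
  from B_equation_solutions[OF B_equation \<alpha> this]
  obtain k where "\<beta> + \<eta> = 0" and g: "\<alpha> = 1 - a \<and> a \<noteq> 1 \<and> k \<noteq> 0 \<and> cocB = [:k:] \<or>
      \<alpha> = 1 \<and> a = 1 \<and> k \<noteq> 0 \<and> cocB = [:0, k:]"
    by blast
  have "(x + \<alpha> * y) * poly cocA x - (y + \<alpha> * x) * poly cocA y =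
    (x - y) * poly cocA (x + y) + poly (poly Q [:x:]) (- x - y) * poly cocB (x + y)" for x y
    using A_B_equation[of x y] unfolding \<open>\<beta> + \<eta> = 0\<close> by simp
  from A_equation_excludes_B[OF this Q g] show False .
qed

lemma A_equation_cocA: "A_equation cocA"
  unfolding A_equation_def using A_B_equation cocB_zero by simp

text \<open>A map to the direct sum that respects the sequence is determined by its first component, a
  retraction of the extension onto \<open>\<complex>c\<close>; since the algebra acts by zero on \<open>\<complex>c\<close>, that component is an
  eigenfunctional that vanishes on the action.\<close>

lemma trivial_ext_iff_retraction:
  "trivial_ext sC aC sV aV sE aE i p \<longleftrightarrow>
    (\<exists>\<chi>. eigenfunctional sE \<eta> \<chi> \<and> \<chi> (i c) = 1 \<and> (\<forall>b e x. ev \<chi> (aE b e) x = 0))"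
proof
  assume "trivial_ext sC aC sV aV sE aE i p"
  then obtain h where h: "conformal_hom sE aE (sum_smul sC sV) (sum_act aC aV) h"
    and hi: "h \<circ> i = (\<lambda>x. (x, 0))"
    unfolding trivial_ext_def ext_equiv_def by blast
  interpret h: module_hom sE "sum_smul sC sV" h
    using h by (simp add: conformal_hom_def)
  note e = eigenfunctional_coordc
  note add = eigenfunctional_additive[OF e]
  have fst0: "ev (\<lambda>z. coordc (fst z)) (sum_act aC aV b z) x = 0" for b z x
  proof -
    have "additive (\<lambda>z. coordc (fst z))"
      by unfold_locales (simp add: additive.add[OF add])
    moreover have "ev (\<lambda>z. coordc (fst z)) (map_poly (\<lambda>y. (0, y)) q) x = 0" for q :: "'v poly"
      by (simp add: ev_map_poly[of "\<lambda>z. coordc (fst z)"] additive.zero[OF add] zero_prod_def)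
    ultimately show ?thesis by (simp add: sum_act_def poly_pair_def)
  qed
  have "eigenfunctional sE \<eta> (\<lambda>e. coordc (fst (h e)))"
    by (simp add: eigenfunctional_def additive_def h.add h.scale sum_smul_def
        additive.add[OF add] eigenfunctional_smul[OF e])
  moreover have "coordc (fst (h (i c))) = 1"
    using fun_cong[OF hi, of c] by simp
  moreover have "ev (\<lambda>e. coordc (fst (h e))) (aE b e) x = 0" for b e x
  proof -
    have "ev (\<lambda>e. coordc (fst (h e))) (aE b e) x = ev (\<lambda>z. coordc (fst z)) (map_poly h (aE b e)) x"
      by (simp add: ev_map_poly[of "\<lambda>z. coordc (fst z)"] additive.zero[OF add])
    also have "map_poly h (aE b e) = sum_act aC aV b (h e)"
      using h by (simp add: conformal_hom_def)
    finally show ?thesis by (simp only: fst0)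
  qed
  ultimately show "\<exists>\<chi>. eigenfunctional sE \<eta> \<chi> \<and> \<chi> (i c) = 1 \<and> (\<forall>b e x. ev \<chi> (aE b e) x = 0)"
    by blast
next
  assume "\<exists>\<chi>. eigenfunctional sE \<eta> \<chi> \<and> \<chi> (i c) = 1 \<and> (\<forall>b e x. ev \<chi> (aE b e) x = 0)"
  then obtain \<chi> where e: "eigenfunctional sE \<eta> \<chi>" and c1: "\<chi> (i c) = 1"
    and act: "\<And>b e x. ev \<chi> (aE b e) x = 0" by blast
  note add = eigenfunctional_additive[OF e]
  define h where "h e = (scal sC (\<chi> e) c, p e)" for e
  have "module (sum_smul sC sV)"
    by unfold_locales
      (simp_all add: sum_smul_def CM.V.scale_right_distrib VM.V.scale_right_distrib
        CM.V.scale_left_distrib VM.V.scale_left_distrib)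
  then have "module_hom sE (sum_smul sC sV) h"
    by (intro module_hom.intro module_hom_axioms.intro EM.V.module_axioms)
      (simp_all add: h_def additive.add[OF add] eigenfunctional_smul[OF e] sum_smul_def smul_scal_c
        p.add p.scale del: CM.V.scale_scale flip: CM.V.scale_left_distrib)
  moreover have "sum_act aC aV b (h e) = map_poly h (aE b e)" for b e
  proof (rule poly_eqI)
    fix n
    have "\<chi> (coeff (aE b e) n) = 0"
      by (rule ev_eq_0D[where \<chi> = \<chi>, OF additive.zero[OF add] act])
    then show "coeff (sum_act aC aV b (h e)) n = coeff (map_poly h (aE b e)) n"
      by (simp add: sum_act_def poly_pair_def h_def p_act coeff_map_poly additive.zero[OF add]
          zero_prod_def)
  qed
  moreover have "h \<circ> i = (\<lambda>x. (x, 0))"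
  proof
    fix x
    have "\<chi> (i x) = coordc x"
      by (subst expand_C[of x]) (simp add: i.scale eigenfunctional_smul[OF e] c1)
    then show "(h \<circ> i) x = (x, 0)" by (simp add: h_def flip: expand_C)
  qed
  moreover have "snd \<circ> h = p" by (simp add: h_def fun_eq_iff)
  ultimately show "trivial_ext sC aC sV aV sE aE i p"
    unfolding trivial_ext_def ext_equiv_def conformal_hom_def by blast
qed

text \<open>A retraction \<open>\<chi>\<close> agrees with the \<open>c\<close>-coordinate on \<open>\<complex>c\<close>, so it is fixed by the single number
  \<open>\<chi>(u) = -k\<close>.\<close>

lemma trivial_ext_iff: "trivial_ext sC aC sV aV sE aE i p \<longleftrightarrow> (\<exists>k. cocA = [:k * (\<beta> + \<eta>), k * \<alpha>:])"
proof
  assume "trivial_ext sC aC sV aV sE aE i p"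
  then obtain \<chi> where e: "eigenfunctional sE \<eta> \<chi>" and "\<chi> (i c) = 1"
    and "\<And>b e x. ev \<chi> (aE b e) x = 0"
    unfolding trivial_ext_iff_retraction by blast
  then have "poly cocA x = poly [:- \<chi> u * (\<beta> + \<eta>), - \<chi> u * \<alpha>:] x" for x
    using ev_aE_u(1)[OF e, of x] by (simp add: algebra_simps eq_neg_iff_add_eq_0)
  then have "cocA = [:- \<chi> u * (\<beta> + \<eta>), - \<chi> u * \<alpha>:]" by (rule poly_ext)
  then show "\<exists>k. cocA = [:k * (\<beta> + \<eta>), k * \<alpha>:]" by (rule exI)
next
  assume "\<exists>k. cocA = [:k * (\<beta> + \<eta>), k * \<alpha>:]"
  then obtain k where k: "cocA = [:k * (\<beta> + \<eta>), k * \<alpha>:]" ..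
  define \<chi> where "\<chi> e = coordE e - k * poly (coordv (p e)) \<eta>" for e
  have e: "eigenfunctional sE \<eta> \<chi>"
    by (simp add: eigenfunctional_def additive_def \<chi>_def additive.add[OF additive_coordE]
        eigenfunctional_smul[OF eigenfunctional_coordE] p.add p.scale coordv_add coordv_smul algebra_simps)
  have ic: "\<chi> (i c) = 1" and u: "\<chi> u = - k"
    by (simp_all add: \<chi>_def p_u coordv_v)
  have "ev \<chi> (aE b e) x = 0" for b e x
  proof -
    have gen: "ev \<chi> (aE b e) x = 0" if "ev \<chi> (aE b u) x = 0" for b
    proof -
      note e' = EM.eigenfunctional_act_right[OF e, of x b]
      show ?thesis
        by (subst expand_E[of e])
          (simp only: additive.add[OF eigenfunctional_additive[OF e']] eigenfunctional_smul[OF e'] that,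
           simp)
    qed
    have "ev \<chi> (aE A u) x = 0" "ev \<chi> (aE B u) x = 0"
      unfolding ev_aE_u[OF e] ic u k cocB_zero by (simp_all add: algebra_simps)
    then show ?thesis by (simp add: ev_act_R[OF CE e, of b e x] gen)
  qed
  with e ic show "trivial_ext sC aC sV aV sE aE i p"
    unfolding trivial_ext_iff_retraction by blast
qed

text \<open>The action of the extension plus the cocycle of \<open>f\<close>; the \<open>\<complex>[\<partial>]\<close>-module stays the same.\<close>

definition "shift_act f b e = aE b e + map_poly j (cocycle f b (p e))"

text \<open>The functionals \<open>coordE\<close> and \<open>poly (coordv (p _)) z\<close> separate the points of the extension. The latter
  factor through the quotient, where the action has not changed; for the former, the Jacobi identities of
  the old action and of the cocycle add up, because the cocycle takes values in \<open>\<complex>c\<close>, where the algebra acts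
  by zero.\<close>

lemma extension_shift:
  assumes f: "A_equation f"
  shows "extension sR br sC aC sV aV sE (shift_act f) i p"
proof -
  note jadd = map_poly_plus[OF additive_j]
  have cadd: "cocycle f (b + b') w = cocycle f b w + cocycle f b' w"
    "cocycle f b (w + w') = cocycle f b w + cocycle f b w'" for b b' w w'
    by (simp_all add: cocycle_def coordA_add coordv_add pcompose_add algebra_simps)
  have cscal: "cocycle f (sR P b) w = pcompose P [:0, -1:] * cocycle f b w"
    "cocycle f b (sV P w) = pcompose P [:\<eta>, 1:] * cocycle f b w" for P b w
    by (simp_all add: cocycle_def coordA_smul coordv_smul pcompose_mult algebra_simps)
  have jsmult: "map_poly j (smult k q) = map_poly (scal sE k) (map_poly j q)" for k q
    by (rule poly_eqI) (simp add: coeff_map_poly mult.commute)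
  have jderiv: "map_poly j (smult \<eta> q) = map_poly (deriv_op sE) (map_poly j q)" for q
    by (rule poly_eqI) (simp only: coeff_map_poly j_zero EM.V.scale_zero_right deriv_j coeff_smult)
  have jminus: "map_poly j (- q) = - map_poly j q" for q
    by (rule poly_eqI) (simp add: coeff_map_poly flip: EM.V.scale_minus_left)
  have mapadd: "map_poly (sE P) (q + q') = map_poly (sE P) q + map_poly (sE P) q'" for P q q'
    by (rule map_poly_plus) (simp add: additive_def EM.V.scale_right_distrib)
  have add_left: "shift_act f (b + b') e = shift_act f b e + shift_act f b' e"
    and add_right: "shift_act f b (e + e') = shift_act f b e + shift_act f b e'" for b b' e e'
    by (simp_all add: shift_act_def EM.act_add_left EM.act_add_right p.add cadd jadd)
  have ev_coordE: "ev coordE (shift_act f b e) x = ev coordE (aE b e) x + poly (cocycle f b (p e)) x" for b e x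
    by (simp add: shift_act_def ev_add_poly[OF additive_coordE] ev_map_poly[of coordE])
  have p_shift: "map_poly p (shift_act f b e) = aV b (p e)" for b e
  proof -
    have "additive p" by unfold_locales (rule p.add)
    moreover have "map_poly (\<lambda>_. 0) q = (0 :: 'v poly)" for q :: "complex poly"
      by (rule poly_eqI) (simp add: coeff_map_poly)
    ultimately show ?thesis
      by (simp add: shift_act_def map_poly_plus p_act map_poly_map_poly comp_def)
  qed
  have jac1: "jacobi_at br (shift_act f) coordE"
    unfolding jacobi_at_def
  proof (intro allI)
    fix b b' e x y
    have zeros: "cocycle f b 0 = 0" "cocycle f 0 w = 0" for b w
      using cscal[of 0] by (simp_all add: cocycle_def)
    have outer: "ev (\<lambda>n. ev coordE (shift_act f b n) x) (shift_act f b' e) y =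
        ev (\<lambda>n. ev coordE (aE b n) x) (aE b' e) y
        + ev (\<lambda>w. poly (cocycle f b w) x) (aV b' (p e)) y" for b b' x y
    proof -
      note g = EM.eigenfunctional_act_right[OF eigenfunctional_coordE, of x b]
      have "ev (\<lambda>n. ev coordE (aE b n) x) (shift_act f b' e) y = ev (\<lambda>n. ev coordE (aE b n) x) (aE b' e) y"
        unfolding shift_act_def ev_add_poly[OF eigenfunctional_additive[OF g]]
        by (simp add: ev_map_poly[where \<chi> = "\<lambda>n. ev coordE (aE b n) x"])
      moreover have "ev (\<lambda>n. poly (cocycle f b (p n)) x) (shift_act f b' e) y =
          ev (\<lambda>w. poly (cocycle f b w) x) (aV b' (p e)) y"
        unfolding p_shift[symmetric]
        by (simp add: ev_map_poly[where \<chi> = "\<lambda>w. poly (cocycle f b w) x"] zeros)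
      ultimately show ?thesis
        unfolding ev_coordE
        by (simp add: ev_add_fun[where \<chi> = "\<lambda>n. ev coordE (aE b n) x"] zeros)
    qed
    have middle: "ev (\<lambda>r. ev coordE (shift_act f r e) (x + y)) (br b b') x =
        ev (\<lambda>r. ev coordE (aE r e) (x + y)) (br b b') x
        + ev (\<lambda>r. poly (cocycle f r (p e)) (x + y)) (br b b') x"
      unfolding ev_coordE by (rule ev_add_fun) (simp_all add: zeros)
    show "ev (\<lambda>n. ev coordE (shift_act f b n) x) (shift_act f b' e) y =
       ev (\<lambda>r. ev coordE (shift_act f r e) (x + y)) (br b b') x +
       ev (\<lambda>n. ev coordE (shift_act f b' n) y) (shift_act f b e) x"
      unfolding outer middle
      using jacobi_atD[OF EM.jacobi_at_act[OF additive_coordE], of b x b' e y]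
        cocycle_jacobi[OF f, of b x b' "p e" y] by (simp only: ac_simps)
  qed
  have jac2: "jacobi_at br (shift_act f) (\<lambda>e. poly (coordv (p e)) z)" for z
  proof (rule jacobi_at_comp[where h = p and act = aV and \<chi> = "\<lambda>w. poly (coordv w) z"])
    show "additive (\<lambda>w. poly (coordv w) z)"
      by (rule eigenfunctional_additive[OF eigenfunctional_coordv])
    then show "jacobi_at br aV (\<lambda>w. poly (coordv w) z)" by (rule VM.jacobi_at_act)
    show "additive p" by unfold_locales (rule p.add)
  qed (rule p_shift, rule VM.act_add_right)
  have "conformal_module sR br sE (shift_act f)"
  proof unfold_locales
    fix b b' :: 'r and e e' :: 'e and k :: complex
    show "shift_act f (b + b') e = shift_act f b e + shift_act f b' e" by (rule add_left)
    show "shift_act f b (e + e') = shift_act f b e + shift_act f b e'" by (rule add_right)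
    show "shift_act f (scal sR k b) e = map_poly (scal sE k) (shift_act f b e)"
      by (simp add: shift_act_def EM.act_scal_left cscal mapadd jsmult)
    show "shift_act f b (scal sE k e) = map_poly (scal sE k) (shift_act f b e)"
      by (simp add: shift_act_def EM.act_scal_right p.scale cscal mapadd jsmult)
    show "shift_act f (deriv_op sR b) e = - pCons 0 (shift_act f b e)"
      by (simp add: shift_act_def EM.act_deriv_left cscal pcompose_pCons jminus map_poly_pCons
          del: minus_pCons) simp
    show "shift_act f b (deriv_op sE e) =
        map_poly (deriv_op sE) (shift_act f b e) + pCons 0 (shift_act f b e)"
      by (simp add: shift_act_def EM.act_deriv_right p.scale cscal pcompose_pCons mapadd jadd jderiv
          map_poly_pCons)
    show "map_poly (shift_act f b) (shift_act f b' e) =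
        act_at_sum (shift_act f) (br b b') e + swap_vars (map_poly (shift_act f b') (shift_act f b e))"
    proof (rule jacobi_of_jacobi_at[where X = "insert coordE (range (\<lambda>z e. poly (coordv (p e)) z))"])
      fix m assume z: "\<And>\<chi>. \<chi> \<in> insert coordE (range (\<lambda>z e. poly (coordv (p e)) z)) \<Longrightarrow> \<chi> m = 0"
      show "m = 0"
        by (rule E_separated) (auto intro!: z)
    next
      fix \<chi> assume "\<chi> \<in> insert coordE (range (\<lambda>z e. poly (coordv (p e)) z))"
      then show "additive \<chi> \<and> jacobi_at br (shift_act f) \<chi>"
        using additive_coordE jac1 jac2 eigenfunctional_additive[OF eigenfunctional_coordv_p] by blast
    qed (rule add_left add_right)+
  qed
  moreover have "conformal_hom sC aC sE (shift_act f) i"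
    unfolding conformal_hom_def using i.module_hom_axioms
    by (simp add: shift_act_def cocycle_def)
  moreover have "conformal_hom sE (shift_act f) sV aV p"
    unfolding conformal_hom_def using p.module_hom_axioms by (simp add: p_shift)
  ultimately show ?thesis
    unfolding extension_def using CC CV inj_i range_i surj_p by blast
qed

end

section \<open>The direct sum\<close>

context type_II_data
begin

lemma A_equation_solutions:
  assumes "A_equation f"
  shows "(\<beta> + \<eta> \<noteq> 0 \<longrightarrow> (\<exists>k. f = [:k * (\<beta> + \<eta>), k * \<alpha>:])) \<and>
    (\<beta> + \<eta> = 0 \<longrightarrow> (\<exists>k s. f = [:0, k * \<alpha>:] \<or> \<alpha> = 1 \<and> f = [:0, k * \<alpha>:] + monom s 2 \<or>
      \<alpha> = 2 \<and> f = [:0, k * \<alpha>:] + monom s 3))"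
  by (rule homogeneous_A_equation_solutions[OF _ \<alpha>]) (use assms in \<open>simp add: A_equation_def\<close>)

text \<open>These monomials are polynomial identities: for instance, for \<open>\<alpha> = 1\<close> the two sides are
  \<open>(x+y)(x\<^sup>2-y\<^sup>2)\<close> and \<open>(x-y)(x+y)\<^sup>2\<close>.\<close>

lemma A_equation_monom:
  fixes n :: nat
  assumes "\<beta> + \<eta> = 0" "\<alpha> = 1 \<and> n = 2 \<or> \<alpha> = 2 \<and> n = 3"
  shows "A_equation (monom s n)"
  using assms(2) unfolding A_equation_def assms(1)
  by (auto simp: poly_monom power2_eq_square power3_eq_cube algebra_simps)

lemma A_equation_diff:
  assumes "A_equation f" "A_equation g"
  shows "A_equation (f - g)"
  unfolding A_equation_def
proof (intro allI)
  fix x y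
  show "(\<beta> + \<eta> + x + \<alpha> * y) * poly (f - g) x - (\<beta> + \<eta> + y + \<alpha> * x) * poly (f - g) y
      = (x - y) * poly (f - g) (x + y)"
    using assms[unfolded A_equation_def, rule_format, of x y] unfolding poly_diff by algebra
qed

text \<open>The first component of the action is zero, so the functionals on \<open>\<complex>c\<close> see the Jacobi identity as
  \<open>0 = 0 + 0\<close>, and the others see the one of the second summand.\<close>

lemma direct_sum_extension:
  "extension sR br sC aC sV aV (sum_smul sC sV) (sum_act aC aV) (\<lambda>x. (x, 0)) snd"
proof -
  have module: "module (sum_smul sC sV)"
    by unfold_locales
      (simp_all add: sum_smul_def CM.V.scale_right_distrib VM.V.scale_right_distrib
        CM.V.scale_left_distrib VM.V.scale_left_distrib)
  have act: "sum_act aC aV b z = map_poly (\<lambda>y. (0, y)) (aV b (snd z))" for b z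
    by (simp add: sum_act_def poly_pair_def)
  have coeff_act: "coeff (sum_act aC aV b z) n = (0, coeff (aV b (snd z)) n)" for b z n
    by (simp add: act coeff_map_poly zero_prod_def)
  have snd_act: "map_poly snd (sum_act aC aV b z) = aV b (snd z)" for b z
    by (rule poly_eqI) (simp add: coeff_map_poly coeff_act)
  have add_left: "sum_act aC aV (b + b') z = sum_act aC aV b z + sum_act aC aV b' z"
    and add_right: "sum_act aC aV b (z + z') = sum_act aC aV b z + sum_act aC aV b z'" for b b' z z'
    by (rule poly_eqI; simp add: coeff_act VM.act_add_left VM.act_add_right)+
  note addc = eigenfunctional_additive[OF eigenfunctional_coordc]
  have add_fst: "additive (\<lambda>z. coordc (fst z))"
    by unfold_locales (simp add: additive.add[OF addc])
  have add_snd: "additive (snd :: 'c \<times> 'v \<Rightarrow> 'v)"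
    by unfold_locales simp
  have add_coordv: "additive (\<lambda>w. poly (coordv w) y)" for y
    by (rule eigenfunctional_additive[OF eigenfunctional_coordv])
  have "ev (\<lambda>z. coordc (fst z)) (sum_act aC aV b z) x = 0" for b z x
    by (simp add: act ev_map_poly[where \<chi> = "\<lambda>z. coordc (fst z)"] additive.zero[OF addc] zero_prod_def)
  then have jac1: "jacobi_at br (sum_act aC aV) (\<lambda>z. coordc (fst z))"
    by (simp add: jacobi_at_def)
  have jac2: "jacobi_at br (sum_act aC aV) (\<lambda>z. poly (coordv (snd z)) y)" for y
    by (rule jacobi_at_comp[OF VM.jacobi_at_act[OF add_coordv] add_coordv add_snd snd_act VM.act_add_right])
  interpret module "sum_smul sC sV" by (rule module)
  have "conformal_module sR br (sum_smul sC sV) (sum_act aC aV)"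
  proof unfold_locales
    fix b b' :: 'r and z z' :: "'c \<times> 'v" and k :: complex
    show "sum_act aC aV (b + b') z = sum_act aC aV b z + sum_act aC aV b' z" by (rule add_left)
    show "sum_act aC aV b (z + z') = sum_act aC aV b z + sum_act aC aV b z'" by (rule add_right)
    show "sum_act aC aV (scal sR k b) z = map_poly (scal (sum_smul sC sV) k) (sum_act aC aV b z)"
      by (rule poly_eqI) (simp add: coeff_act coeff_map_poly VM.act_scal_left sum_smul_def zero_prod_def)
    show "sum_act aC aV b (scal (sum_smul sC sV) k z) = map_poly (scal (sum_smul sC sV) k) (sum_act aC aV b z)"
      by (rule poly_eqI) (simp add: coeff_act coeff_map_poly VM.act_scal_right sum_smul_def zero_prod_def)
    show "sum_act aC aV (deriv_op sR b) z = - pCons 0 (sum_act aC aV b z)"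
      by (rule poly_eqI)
        (simp add: coeff_act VM.act_deriv_left coeff_pCons zero_prod_def split: nat.split del: minus_pCons)
    show "sum_act aC aV b (deriv_op (sum_smul sC sV) z) =
        map_poly (deriv_op (sum_smul sC sV)) (sum_act aC aV b z) + pCons 0 (sum_act aC aV b z)"
      by (rule poly_eqI)
        (simp add: coeff_act VM.act_deriv_right coeff_pCons coeff_map_poly sum_smul_def zero_prod_def
          split: nat.split)
    show "map_poly (sum_act aC aV b) (sum_act aC aV b' z) =
        act_at_sum (sum_act aC aV) (br b b') z + swap_vars (map_poly (sum_act aC aV b') (sum_act aC aV b z))"
    proof (rule jacobi_of_jacobi_at[where
          X = "insert (\<lambda>z. coordc (fst z)) (range (\<lambda>y z. poly (coordv (snd z)) y))"])
      fix m :: "'c \<times> 'v"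
      assume z: "\<And>\<chi>. \<chi> \<in> insert (\<lambda>z. coordc (fst z)) (range (\<lambda>y z. poly (coordv (snd z)) y)) \<Longrightarrow> \<chi> m = 0"
      have "coordc (fst m) = 0" by (rule z) simp
      then have "fst m = 0" by (subst expand_C) simp
      have "poly (coordv (snd m)) y = 0" for y
        using z[of "\<lambda>z. poly (coordv (snd z)) y"] by blast
      then have "coordv (snd m) = 0" by (rule poly_zeroI)
      then have "snd m = 0" by (subst expand_V) simp
      with \<open>fst m = 0\<close> show "m = 0" by (simp add: prod_eq_iff)
    next
      fix \<chi> assume "\<chi> \<in> insert (\<lambda>z. coordc (fst z)) (range (\<lambda>y z. poly (coordv (snd z)) y))"
      moreover have "additive (\<lambda>z :: 'c \<times> 'v. poly (coordv (snd z)) y)" for y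
        by unfold_locales (simp add: coordv_add)
      ultimately show "additive \<chi> \<and> jacobi_at br (sum_act aC aV) \<chi>"
        using add_fst jac1 jac2 by blast
    qed (rule add_left add_right)+
  qed
  moreover have "conformal_hom sC aC (sum_smul sC sV) (sum_act aC aV) (\<lambda>x. (x, 0))"
    unfolding conformal_hom_def
    by (intro conjI allI module_hom.intro module_hom_axioms.intro CM.V.module_axioms module)
      (simp_all add: sum_smul_def act)
  moreover have "conformal_hom (sum_smul sC sV) (sum_act aC aV) sV aV snd"
    unfolding conformal_hom_def
    by (intro conjI allI module_hom.intro module_hom_axioms.intro VM.V.module_axioms module)
      (simp_all add: sum_smul_def snd_act)
  ultimately show ?thesis
    unfolding extension_def using CC CV by (auto simp: inj_def image_iff surj_def)
qed

end


section \<open>Classification of the nontrivial extensions\<close>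

context type_II_extension
begin

lemma extension_with_lift:
  assumes "p u' = v"
  shows "type_II_extension sR br A B a Q \<alpha> \<beta> \<eta> sV aV v sC aC c sE aE i p u'"
  using ext assms by unfold_locales

lemma shift_type_II_extension:
  assumes "A_equation f"
  shows "type_II_extension sR br A B a Q \<alpha> \<beta> \<eta> sV aV v sC aC c sE (shift_act f) i p u"
  using extension_shift[OF assms] p_u by unfold_locales

lemma cocA_shift: "map_poly coordE (shift_act f A u) = cocA + f"
  unfolding shift_act_def map_poly_plus[OF additive_coordE] map_coordE_j
  by (simp add: cocA_def p_u)

lemma standard_form_change_lift:
  "standard_form sE aE A B \<alpha> \<beta> \<eta> (i c) (u + j k) (cocA - [:k * (\<beta> + \<eta>), k * \<alpha>:]) 0"
proof -
  have "p (u + j k) = v" by (simp add: p.add p_u)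
  then interpret X: type_II_extension sR br A B a Q \<alpha> \<beta> \<eta> sV aV v sC aC c sE aE i p "u + j k"
    by (rule extension_with_lift)
  have "X.coordE u + k = 0"
    using X.coordE_u unfolding additive.add[OF X.additive_coordE] by simp
  then have u: "X.coordE u = - k" by (simp add: eq_neg_iff_add_eq_0)
  have "poly X.cocA x = poly (cocA - [:k * (\<beta> + \<eta>), k * \<alpha>:]) x" for x
    using ev_aE_u(1)[OF X.eigenfunctional_coordE, of x]
    by (simp add: X.poly_cocA EM.act_add_right u algebra_simps)
  then have "X.cocA = cocA - [:k * (\<beta> + \<eta>), k * \<alpha>:]" by (rule poly_ext)
  then show ?thesis unfolding X.standard_form_iff by (simp add: X.cocB_zero)
qed

text \<open>The multiple of \<open>x\<close> in \<open>f\<close> is removed by a change of the lift. Conversely the monomials of degree 2 and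
  3 are not multiples of \<open>\<alpha>x\<close>.\<close>

lemma nontrivial_iff:
  "\<not> trivial_ext sC aC sV aV sE aE i p \<longleftrightarrow>
     \<beta> + \<eta> = 0 \<and>
     (\<exists>u s. p u = v \<and> s \<noteq> 0 \<and>
        ((\<alpha> = 1 \<and> standard_form sE aE A B \<alpha> \<beta> \<eta> (i c) u (monom s 2) 0) \<or>
         (\<alpha> = 2 \<and> standard_form sE aE A B \<alpha> \<beta> \<eta> (i c) u (monom s 3) 0)))"
  (is "?L \<longleftrightarrow> ?R")
proof
  assume nontrivial: ?L
  then have no: "cocA \<noteq> [:k * (\<beta> + \<eta>), k * \<alpha>:]" for k
    unfolding trivial_ext_iff by blast
  note sol = A_equation_solutions[OF A_equation_cocA]
  have \<gamma>: "\<beta> + \<eta> = 0" using sol no by blast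
  with sol no obtain k s where ks: "\<alpha> = 1 \<and> cocA = [:0, k * \<alpha>:] + monom s 2 \<or>
      \<alpha> = 2 \<and> cocA = [:0, k * \<alpha>:] + monom s 3" by fastforce
  have s: "s \<noteq> 0" using ks no[of k] \<gamma> by auto
  have p: "p (u + j k) = v" by (simp add: p.add p_u)
  have "cocA - [:k * (\<beta> + \<eta>), k * \<alpha>:] = monom s 2 \<and> \<alpha> = 1 \<or>
      cocA - [:k * (\<beta> + \<eta>), k * \<alpha>:] = monom s 3 \<and> \<alpha> = 2"
    using ks \<gamma> by auto
  with standard_form_change_lift[of k] p s \<gamma> show ?R by metis
next
  assume ?R
  then obtain u' s n where \<gamma>: "\<beta> + \<eta> = 0" and u': "p u' = v" and "s \<noteq> 0" and n: "n = 2 \<or> n = (3 :: nat)"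
    and s: "standard_form sE aE A B \<alpha> \<beta> \<eta> (i c) u' (monom s n) 0" by blast
  interpret X: type_II_extension sR br A B a Q \<alpha> \<beta> \<eta> sV aV v sC aC c sE aE i p u'
    by (rule extension_with_lift[OF u'])
  have "X.cocA = monom s n" using s by (simp add: X.standard_form_iff)
  show ?L
  proof
    assume "trivial_ext sC aC sV aV sE aE i p"
    then obtain k where "monom s n = [:k * (\<beta> + \<eta>), k * \<alpha>:]"
      using \<open>X.cocA = monom s n\<close> unfolding X.trivial_ext_iff by auto
    from arg_cong[OF this, of "\<lambda>q. coeff q n"] n \<open>s \<noteq> 0\<close> show False
      by (auto simp: eval_nat_numeral)
  qed
qed

end


section \<open>Existence and the dimension of Ext\<close>

context type_II_data
begin

text \<open>The polynomial of the direct sum and the monomial both satisfy the linear equation, so the direct sum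
  can be shifted by their difference.\<close>

lemma listed_extension_exists:
  fixes n :: nat
  assumes "\<beta> + \<eta> = 0" "\<alpha> = 1 \<and> n = 2 \<or> \<alpha> = 2 \<and> n = 3" "s \<noteq> 0"
  shows "\<exists>(sE :: complex poly \<Rightarrow> 'c \<times> 'v \<Rightarrow> 'c \<times> 'v) aE i p u.
    extension sR br sC aC sV aV sE aE i p \<and> \<not> trivial_ext sC aC sV aV sE aE i p \<and>
    p u = v \<and> standard_form sE aE A B \<alpha> \<beta> \<eta> (i c) u (monom s n) 0"
proof -
  interpret D: type_II_extension sR br A B a Q \<alpha> \<beta> \<eta> sV aV v sC aC c
      "sum_smul sC sV" "sum_act aC aV" "\<lambda>x. (x, 0)" snd "(0, v)"
    by unfold_locales (rule direct_sum_extension, simp)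
  define f where "f = monom s n - D.cocA"
  have f: "A_equation f"
    unfolding f_def by (rule A_equation_diff[OF A_equation_monom[OF assms(1,2)] D.A_equation_cocA])
  interpret X: type_II_extension sR br A B a Q \<alpha> \<beta> \<eta> sV aV v sC aC c
      "sum_smul sC sV" "D.shift_act f" "\<lambda>x. (x, 0)" snd "(0, v)"
    by (rule D.shift_type_II_extension[OF f])
  have "X.cocA = monom s n"
    unfolding X.cocA_def D.cocA_shift by (simp add: f_def)
  then have std: "standard_form (sum_smul sC sV) (D.shift_act f) A B \<alpha> \<beta> \<eta> (c, 0) (0, v) (monom s n) 0"
    unfolding X.standard_form_iff by (simp add: X.cocB_zero)
  then have "\<not> trivial_ext sC aC sV aV (sum_smul sC sV) (D.shift_act f) (\<lambda>x. (x, 0)) snd"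
    unfolding X.nontrivial_iff using assms X.p_u by blast
  with X.ext X.p_u std show ?thesis by blast
qed

abbreviation "Z \<equiv> ext_cocycles sR br sV aV sC aC"
abbreviation "N \<equiv> trivial_cocycles sR br sV aV sC aC"

text \<open>The map itself, with values in the module instead of in coordinates.\<close>

definition "cocycle_map f b w = map_poly (\<lambda>k. scal sC k c) (cocycle f b w)"

text \<open>The polynomial \<open>h\<close> is that of the twisted direct sum for the lift \<open>(0, v)\<close>. Adding the cocycle of \<open>f\<close>
  to \<open>\<psi>\<close> is a shift of its action.\<close>

lemma cocycle_shift:
  assumes "(\<phi>, \<psi>) \<in> Z"
  obtains h where "A_equation h"
    and "\<And>f. A_equation f \<Longrightarrow> (\<phi>, \<lambda>b w. \<psi> b w + cocycle_map f b w) \<in> Z"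
    and "\<And>f. A_equation f \<Longrightarrow> (\<phi>, \<lambda>b w. \<psi> b w + cocycle_map f b w) \<in> N \<longleftrightarrow>
      (\<exists>k. h + f = [:k * (\<beta> + \<eta>), k * \<alpha>:])"
proof -
  have \<phi>: "\<phi> [:k:] w = 0" for k w using assms by (simp add: ext_cocycles_def)
  have twisted: "extension sR br sC aC sV aV (twist_smul sC sV \<phi>) (twist_act aC aV \<psi>) (\<lambda>x. (x, 0)) snd"
    using assms unfolding ext_cocycles_def mem_Collect_eq prod.case by (rule conjunct2)
  interpret E: type_II_extension sR br A B a Q \<alpha> \<beta> \<eta> sV aV v sC aC c
      "twist_smul sC sV \<phi>" "twist_act aC aV \<psi>" "\<lambda>x. (x, 0)" snd "(0, v)"
    by (intro type_II_extension.intro type_II_extension_axioms.intro type_II_data_axioms twisted snd_conv)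
  have additive_inl: "additive (\<lambda>x :: 'c. (x, 0 :: 'v))"
    by unfold_locales simp
  have act: "twist_act aC aV (\<lambda>b w. \<psi> b w + cocycle_map f b w) = E.shift_act f" for f
  proof (intro ext)
    fix b z
    have "poly_pair (q + q') r = poly_pair q r + map_poly (\<lambda>x. (x, 0)) q'"
      for q q' :: "'c poly" and r :: "'v poly"
      by (simp add: poly_pair_def map_poly_plus[OF additive_inl] algebra_simps)
    moreover have "map_poly (\<lambda>x. (x, 0)) (cocycle_map f b w) = map_poly E.j (cocycle f b w)" for w
      by (rule poly_eqI)
        (simp add: cocycle_map_def coeff_map_poly twist_smul_def \<phi>)
    ultimately show "twist_act aC aV (\<lambda>b w. \<psi> b w + cocycle_map f b w) b z = E.shift_act f b z"
      by (simp add: twist_act_def E.shift_act_def)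
  qed
  have inZ: "(\<phi>, \<lambda>b w. \<psi> b w + cocycle_map f b w) \<in> Z" if "A_equation f" for f
    using E.extension_shift[OF that] by (simp add: ext_cocycles_def \<phi> act)
  show ?thesis
  proof (rule that[OF E.A_equation_cocA inZ])
    fix f assume f: "A_equation f"
    interpret X: type_II_extension sR br A B a Q \<alpha> \<beta> \<eta> sV aV v sC aC c
        "twist_smul sC sV \<phi>" "E.shift_act f" "\<lambda>x. (x, 0)" snd "(0, v)"
      by (rule E.shift_type_II_extension[OF f])
    have "X.cocA = E.cocA + f" unfolding X.cocA_def by (rule E.cocA_shift)
    then show "(\<phi>, \<lambda>b w. \<psi> b w + cocycle_map f b w) \<in> N \<longleftrightarrow>
        (\<exists>k. E.cocA + f = [:k * (\<beta> + \<eta>), k * \<alpha>:])"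
      using X.trivial_ext_iff inZ[OF f] by (simp add: trivial_cocycles_def act)
  qed
qed

text \<open>The polynomial \<open>h\<close> of a cocycle is \<open>k\<alpha>x + tx\<^sup>n\<close>, and \<open>t\<close> is the coefficient of its class with respect
  to the class of the listed cocycle.\<close>

lemma ext_dim_1:
  fixes n :: nat
  assumes \<gamma>: "\<beta> + \<eta> = 0" and n: "\<alpha> = 1 \<and> n = 2 \<or> \<alpha> = 2 \<and> n = 3"
  shows "ext_dim sR br sV aV sC aC 1"
proof -
  define \<zeta> :: "('r, 'v, 'c) cochain" where
    "\<zeta> = (\<lambda>_ _. 0, cocycle_map (monom 1 n))"
  have zero: "((\<lambda>_ _. 0, \<lambda>_ _. 0) :: ('r, 'v, 'c) cochain) \<in> Z"
  proof -
    have "twist_smul sC sV (\<lambda>_ _. 0) = sum_smul sC sV" "twist_act aC aV (\<lambda>_ _. 0) = sum_act aC aV"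
      by (simp_all add: fun_eq_iff twist_smul_def sum_smul_def twist_act_def sum_act_def)
    then show ?thesis using direct_sum_extension by (simp add: ext_cocycles_def)
  qed
  note mon = A_equation_monom[OF \<gamma> n]
  have \<zeta>: "\<zeta> \<in> Z"
    by (rule cocycle_shift[OF zero]) (use mon[of 1] in \<open>auto simp: \<zeta>_def\<close>)
  have sub: "(\<phi>, \<psi>) - cochain_scale sC k \<zeta> = (\<phi>, \<lambda>b w. \<psi> b w + cocycle_map (monom (- k) n) b w)"
    for \<phi> \<psi> k
  proof -
    have c: "cocycle (monom k n) b w = smult k (cocycle (monom 1 n) b w)" for k b w
      using mult_smult_right[of _ k "monom 1 n"] by (simp add: cocycle_def smult_monom)
    have "map_poly (scal sC k) (cocycle_map (monom 1 n) b w) = - cocycle_map (monom (- k) n) b w" for b w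
      by (intro poly_eqI) (simp add: cocycle_map_def c[of "- k"] coeff_map_poly mult.commute flip: CM.V.scale_minus_left)
    then show ?thesis
      by (simp add: cochain_scale_def \<zeta>_def fun_eq_iff)
  qed
  have "\<exists>!k. (\<forall>s. s \<notin> {\<zeta>} \<longrightarrow> k s = 0) \<and> z - (\<Sum>s\<in>{\<zeta>}. cochain_scale sC (k s) s) \<in> N" if "z \<in> Z" for z
  proof -
    obtain \<phi> \<psi> where z: "z = (\<phi>, \<psi>)" by fastforce
    with \<open>z \<in> Z\<close> have "(\<phi>, \<psi>) \<in> Z" by simp
    then obtain h where h: "A_equation h"
      and N: "\<And>f. A_equation f \<Longrightarrow> (\<phi>, \<lambda>b w. \<psi> b w + cocycle_map f b w) \<in> N \<longleftrightarrow>
        (\<exists>k. h + f = [:k * (\<beta> + \<eta>), k * \<alpha>:])"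
      by (rule cocycle_shift) blast
    have "\<exists>k t. h = [:0, k * \<alpha>:] + monom t n"
    proof -
      obtain k s where "h = [:0, k * \<alpha>:] \<or> \<alpha> = 1 \<and> h = [:0, k * \<alpha>:] + monom s 2 \<or>
          \<alpha> = 2 \<and> h = [:0, k * \<alpha>:] + monom s 3"
        using A_equation_solutions[OF h] \<gamma> by blast
      then have "h = [:0, k * \<alpha>:] + monom 0 n \<or> h = [:0, k * \<alpha>:] + monom s n"
        using n by auto
      then show ?thesis by blast
    qed
    then obtain k0 t where h: "h = [:0, k0 * \<alpha>:] + monom t n" by blast
    have mem: "z - cochain_scale sC l \<zeta> \<in> N \<longleftrightarrow> l = t" for l
    proof -
      have "z - cochain_scale sC l \<zeta> \<in> N \<longleftrightarrow> (\<exists>k. h + monom (- l) n = [:k * (\<beta> + \<eta>), k * \<alpha>:])"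
        unfolding z sub by (rule N[OF mon])
      also have "\<dots> \<longleftrightarrow> l = t"
      proof
        assume "\<exists>k. h + monom (- l) n = [:k * (\<beta> + \<eta>), k * \<alpha>:]"
        then obtain k where "h + monom (- l) n = [:k * (\<beta> + \<eta>), k * \<alpha>:]" ..
        from arg_cong[OF this, of "\<lambda>q. coeff q n"] n show "l = t"
          by (auto simp: h eval_nat_numeral)
      next
        assume "l = t"
        then have "h + monom (- l) n = [:k0 * (\<beta> + \<eta>), k0 * \<alpha>:]"
          by (simp add: h \<gamma> add.assoc add_monom)
        then show "\<exists>k. h + monom (- l) n = [:k * (\<beta> + \<eta>), k * \<alpha>:]" ..
      qed
      finally show ?thesis .
    qed
    show ?thesis
    proof (rule ex1I[of _ "\<lambda>s. if s = \<zeta> then t else 0"])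
      show "(\<forall>s. s \<notin> {\<zeta>} \<longrightarrow> (if s = \<zeta> then t else 0) = 0) \<and>
          z - (\<Sum>s\<in>{\<zeta>}. cochain_scale sC (if s = \<zeta> then t else 0) s) \<in> N"
        by (simp add: mem)
    next
      fix k assume "(\<forall>s. s \<notin> {\<zeta>} \<longrightarrow> k s = 0) \<and> z - (\<Sum>s\<in>{\<zeta>}. cochain_scale sC (k s) s) \<in> N"
      then show "k = (\<lambda>s. if s = \<zeta> then t else 0)" by (auto simp: mem fun_eq_iff)
    qed
  qed
  then show ?thesis
    unfolding ext_dim_def quotient_dim_def using \<zeta>
    by (intro exI[of _ "{\<zeta>}"]) simp
qed

end

theorem theorem6p2:
  fixes sR :: "complex poly \<Rightarrow> 'r::ab_group_add \<Rightarrow> 'r"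
    and br :: "'r \<Rightarrow> 'r \<Rightarrow> 'r poly"
    and A B :: 'r and a :: complex and Q :: "complex poly poly"
    and \<alpha> \<beta> \<eta> :: complex
    and sV :: "complex poly \<Rightarrow> 'v::ab_group_add \<Rightarrow> 'v" and aV :: "'r \<Rightarrow> 'v \<Rightarrow> 'v poly" and v :: 'v
    and sC :: "complex poly \<Rightarrow> 'c::ab_group_add \<Rightarrow> 'c" and aC :: "'r \<Rightarrow> 'c \<Rightarrow> 'c poly" and c :: 'c
  assumes R: "type_II_algebra sR br A B a Q"
    and V: "irreducible_V sR br A B \<alpha> \<beta> sV aV v"
    and C: "one_dim_module sR br \<eta> sC aC c"
  shows
    \<comment> \<open>every extension has the standard form\<close>
    "(\<forall>(sE :: complex poly \<Rightarrow> 'e::ab_group_add \<Rightarrow> 'e) aE i p.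
        extension sR br sC aC sV aV sE aE i p \<longrightarrow>
        (\<exists>u f g. p u = v \<and> standard_form sE aE A B \<alpha> \<beta> \<eta> (i c) u f g))
   \<and>
    \<comment> \<open>nontrivial extensions exist only if \<open>\<beta> + \<eta> = 0\<close>\<close>
     (\<forall>(sE :: complex poly \<Rightarrow> 'e \<Rightarrow> 'e) aE i p.
        extension sR br sC aC sV aV sE aE i p \<and> \<not> trivial_ext sC aC sV aV sE aE i p \<longrightarrow>
        \<beta> + \<eta> = 0)
   \<and>
    \<comment> \<open>the nontrivial extensions are exactly those listed\<close>
     (\<forall>(sE :: complex poly \<Rightarrow> 'e \<Rightarrow> 'e) aE i p.
        extension sR br sC aC sV aV sE aE i p \<longrightarrow>
        (\<not> trivial_ext sC aC sV aV sE aE i p \<longleftrightarrow>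
         \<beta> + \<eta> = 0 \<and>
         (\<exists>u s. p u = v \<and> s \<noteq> 0 \<and>
            ((\<alpha> = 1 \<and> standard_form sE aE A B \<alpha> \<beta> \<eta> (i c) u (monom s 2) 0) \<or>
             (\<alpha> = 2 \<and> standard_form sE aE A B \<alpha> \<beta> \<eta> (i c) u (monom s 3) 0)))))
   \<and>
    \<comment> \<open>all those listed occur\<close>
     (\<forall>s. \<beta> + \<eta> = 0 \<and> s \<noteq> 0 \<longrightarrow>
        (\<alpha> = 1 \<longrightarrow>
          (\<exists>(sE :: complex poly \<Rightarrow> 'c \<times> 'v \<Rightarrow> 'c \<times> 'v) aE i p u.
             extension sR br sC aC sV aV sE aE i p \<and> \<not> trivial_ext sC aC sV aV sE aE i p \<and>
             p u = v \<and> standard_form sE aE A B \<alpha> \<beta> \<eta> (i c) u (monom s 2) 0)) \<and>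
        (\<alpha> = 2 \<longrightarrow>
          (\<exists>(sE :: complex poly \<Rightarrow> 'c \<times> 'v \<Rightarrow> 'c \<times> 'v) aE i p u.
             extension sR br sC aC sV aV sE aE i p \<and> \<not> trivial_ext sC aC sV aV sE aE i p \<and>
             p u = v \<and> standard_form sE aE A B \<alpha> \<beta> \<eta> (i c) u (monom s 3) 0)))
   \<and>
    \<comment> \<open>the dimension of \<open>Ext(V\<^sub>\<alpha>\<^sub>,\<^sub>\<beta>, \<complex>c\<^sub>\<eta>)\<close> in these cases\<close>
     (\<beta> + \<eta> = 0 \<and> (\<alpha> = 1 \<or> \<alpha> = 2) \<longrightarrow> ext_dim sR br sV aV sC aC 1)"
proof -
  interpret type_II_data sR br A B a Q \<alpha> \<beta> \<eta> sV aV v sC aC c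
    by unfold_locales (fact R V C)+
  have lift: "\<exists>u. type_II_extension sR br A B a Q \<alpha> \<beta> \<eta> sV aV v sC aC c sE aE i p u"
    if E: "extension sR br sC aC sV aV sE aE i p"
    for sE :: "complex poly \<Rightarrow> 'e \<Rightarrow> 'e" and aE i p
  proof -
    have "surj p" using E by (simp add: extension_def)
    then obtain u where "p u = v" by (metis surjD)
    with E have "type_II_extension sR br A B a Q \<alpha> \<beta> \<eta> sV aV v sC aC c sE aE i p u"
      by unfold_locales
    then show ?thesis ..
  qed
  have form: "\<exists>u f g. p u = v \<and> standard_form sE aE A B \<alpha> \<beta> \<eta> (i c) u f g"
    if E: "extension sR br sC aC sV aV sE aE i p"
    for sE :: "complex poly \<Rightarrow> 'e \<Rightarrow> 'e" and aE i p
  proof -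
    obtain u where "type_II_extension sR br A B a Q \<alpha> \<beta> \<eta> sV aV v sC aC c sE aE i p u"
      using lift[OF E] ..
    then interpret type_II_extension sR br A B a Q \<alpha> \<beta> \<eta> sV aV v sC aC c sE aE i p u .
    show ?thesis using standard_form_iff p_u by blast
  qed
  have classify: "\<not> trivial_ext sC aC sV aV sE aE i p \<longleftrightarrow>
     \<beta> + \<eta> = 0 \<and>
     (\<exists>u s. p u = v \<and> s \<noteq> 0 \<and>
        ((\<alpha> = 1 \<and> standard_form sE aE A B \<alpha> \<beta> \<eta> (i c) u (monom s 2) 0) \<or>
         (\<alpha> = 2 \<and> standard_form sE aE A B \<alpha> \<beta> \<eta> (i c) u (monom s 3) 0)))"
    if E: "extension sR br sC aC sV aV sE aE i p"
    for sE :: "complex poly \<Rightarrow> 'e \<Rightarrow> 'e" and aE i p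
    using lift[OF E] by (elim exE) (rule type_II_extension.nontrivial_iff)
  have dim: "ext_dim sR br sV aV sC aC 1" if "\<beta> + \<eta> = 0" "\<alpha> = 1 \<or> \<alpha> = 2"
    using that ext_dim_1[of 2] ext_dim_1[of 3] by blast
  show ?thesis
  proof (intro conjI allI impI)
    fix sE :: "complex poly \<Rightarrow> 'e \<Rightarrow> 'e" and aE i p
    assume "extension sR br sC aC sV aV sE aE i p \<and> \<not> trivial_ext sC aC sV aV sE aE i p"
    then show "\<beta> + \<eta> = 0" using classify by blast
  qed (use form in blast, use classify in blast, use listed_extension_exists in blast,
       use listed_extension_exists in blast, use dim in blast)
qed

end
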